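(* The following are true. (i) For every $l\ge0$, $\sigma_l$ is a real structure on $\mathrm{Sym}^{2l}$ commuting with the action of $\mathrm{SU}(2)$, and $\Psi_l(\bar f)=\sigma_l(\Psi_lf)$ for all $f\in\mathcal H_l^{\mathbb C}$. Hence $\Psi_l(\mathcal H_l)=\operatorname{Fix}(\sigma_l)$. (ii) A nonzero $F\in\mathrm{Sym}^{2l}$ is a complex multiple of a $\sigma_l$-fixed form if and only if its root divisor is invariant under the antipodal map. Every such $F$ factors as $F=\lambda\,Q_{a_1}\cdots Q_{a_l}$ with $a_k\in\mathbb R^3\setminus\{0\}$ and $\lambda\in\mathbb C^\times$; the lines $\mathbb Ra_k$ are determined by $F$ up to order, with multiplicity; and $\lambda$ is real if and only if $F$ is $\sigma_l$-fixed. (iii) Let $I$ be a multihomogeneous $\mathrm{SL}_2(\mathbb C)$-invariant on $V=\bigoplus_{l\le L}\mathrm{Sym}^{2l}$ of multidegree $(d_l)$ with real coefficients. Then for all real harmonics $f_l\in\mathcal H_l$, $l\le L$, $$I\bigl((F_{f_l})_l\bigr)=(-1)^{\sum_l l\,d_l}\;\overline{I\bigl((F_{f_l})_l\bigr)}.$$ (iv) The map $-1\in\mathrm O(3)$ acts on $\mathcal H_l$ by $(-1)^l$, and it multiplies $I$ (as in (iii)) by $(-1)^{\sum_l l d_l}$. If $\sum_lld_l$ is even, $I$ is invariant under $\mathrm O(3)$; if it is odd, $I$ changes sign under every reflection. Every invariant decomposes uniquely as the sum of an even and an odd part.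
   Context: $\mathcal H_l$ (resp. $\mathcal H_l^{\mathbb C}$) is the space of real (resp. complex) homogeneous harmonic polynomials of degree $l$ in $x=(x_1,x_2,x_3)$; conjugation on $\mathcal H_l^{\mathbb C}$ is $\bar f(x)=\overline{f(\bar x)}$. $\mathrm O(3)$ acts by $(A\cdot f)(x)=f(A^{-1}x)$. $\langle\cdot,\cdot\rangle$ is the complex bilinear dot product on $\mathbb C^3$. $\mathrm{Sym}^n$ is the space of complex binary forms $F(z_0,z_1)$ of degree $n$, with $\mathrm{SL}_2(\mathbb C)$ acting by $(g\cdot F)(z)=F(g^{-1}z)$. The Veronese map is $v(z_0,z_1)=(z_0^2-z_1^2,\ i(z_0^2+z_1^2),\ 2z_0z_1)$, $F_f=\Psi_l(f)=f\circ v\in\mathrm{Sym}^{2l}$ for $f\in\mathcal H_l^{\mathbb C}$, and $Q_x(z)=\langle x,v(z)\rangle=(x_1+ix_2)z_0^2+2x_3z_0z_1+(-x_1+ix_2)z_1^2$ for $x\in\mathbb C^3$. The root divisor of $F\neq0$ is the set of zeros of $F$ in $\mathbb P^1$ with multiplicity. $j(z_0,z_1)=(-\bar z_1,\bar z_0)$; the antipodal map is $[z]\mapsto[jz]$ on $\mathbb P^1$ (under the identification $\mathbb P^1\cong\mathbb S^2$ given by $[z]\mapsto(-2\Re(z_0\bar z_1),2\Im(z_0\bar z_1),|z_0|^2-|z_1|^2)/(|z_0|^2+|z_1|^2)$ it is the antipodal map of $\mathbb S^2$). A real structure on a complex vector space is an antilinear map $\sigma$ with $\sigma^2=1$; $\operatorname{Fix}(\sigma)$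 is its fixed set. $\sigma_l(F)(z)=(-1)^l\overline{F(jz)}$ for $F\in\mathrm{Sym}^{2l}$. An invariant is a polynomial $I:V\to\mathbb C$ with $I(g\cdot F)=I(F)$ for $g\in\mathrm{SL}_2(\mathbb C)$ acting summandwise. It is multihomogeneous of multidegree $(d_l)$ if $I((t_lF_l)_l)=\prod_lt_l^{d_l}I((F_l)_l)$. It has real coefficients if it is a real polynomial in the binomial coefficients $a_k$ of the forms, $F=\sum_k\binom{2l}ka_kz_0^{2l-k}z_1^k$. Elements of $\mathrm O(3)$ act on the values of $I$ through $(f_l)_l\mapsto I((F_{f_l})_l)$. The even (odd) part of an invariant is the sum of its multihomogeneous components with $\sum_l l d_l$ even (odd). *)

theory Defs
  imports "HOL-Analysis.Analysis"
begin

(* Polynomials are represented by the polynomial functions they define on a complex vector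
   space; as the base field is infinite this loses nothing. *)

definition hom_poly3 :: "nat \<Rightarrow> (nat \<Rightarrow> nat \<Rightarrow> complex) \<Rightarrow> complex^3 \<Rightarrow> complex" where
  "hom_poly3 l c x = (\<Sum>p\<le>l. \<Sum>q\<le>l - p. c p q * (x$1)^p * (x$2)^q * (x$3)^(l - p - q))"

definition partial_deriv :: "3 \<Rightarrow> (complex^3 \<Rightarrow> complex) \<Rightarrow> complex^3 \<Rightarrow> complex" where
  "partial_deriv i f x = deriv (\<lambda>t. f (x + t *s axis i 1)) 0"

definition laplacian :: "(complex^3 \<Rightarrow> complex) \<Rightarrow> complex^3 \<Rightarrow> complex" where
  "laplacian f x = (\<Sum>i\<in>UNIV. partial_deriv i (partial_deriv i f) x)"

definition harmonicC :: "nat \<Rightarrow> (complex^3 \<Rightarrow> complex) set" where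
  "harmonicC l = {f. (\<exists>c. f = hom_poly3 l c) \<and> (\<forall>x. laplacian f x = 0)}"

(* The real harmonics are viewed inside the complex ones, as the polynomials with real
   coefficients. *)
definition harmonicR :: "nat \<Rightarrow> (complex^3 \<Rightarrow> complex) set" where
  "harmonicR l = {f. (\<exists>c. (\<forall>p q. c p q \<in> \<real>) \<and> f = hom_poly3 l c) \<and> (\<forall>x. laplacian f x = 0)}"

definition cnj_vec :: "complex^'n \<Rightarrow> complex^'n" where
  "cnj_vec x = (\<chi> i. cnj (x$i))"

definition conj_poly :: "(complex^3 \<Rightarrow> complex) \<Rightarrow> complex^3 \<Rightarrow> complex" where
  "conj_poly f x = cnj (f (cnj_vec x))"

definition O3_act :: "real^3^3 \<Rightarrow> (complex^3 \<Rightarrow> complex) \<Rightarrow> complex^3 \<Rightarrow> complex" where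
  "O3_act A f x = f (map_matrix complex_of_real (matrix_inv A) *v x)"

definition is_reflection :: "real^3^3 \<Rightarrow> bool" where
  "is_reflection A \<longleftrightarrow>
     (\<exists>n. n \<noteq> 0 \<and> A = matrix (\<lambda>x. x - (2 * (x \<bullet> n) / (n \<bullet> n)) *\<^sub>R n))"

(* The coordinates z_0, z_1 are the components z$1, z$2. The coefficients a_k carry the binomial
   normalisation. *)
definition binary_form :: "nat \<Rightarrow> (nat \<Rightarrow> complex) \<Rightarrow> complex^2 \<Rightarrow> complex" where
  "binary_form n a z = (\<Sum>k\<le>n. of_nat (n choose k) * a k * (z$1)^(n - k) * (z$2)^k)"

definition Sym :: "nat \<Rightarrow> (complex^2 \<Rightarrow> complex) set" where
  "Sym n = range (binary_form n)"

definition SL2 :: "(complex^2^2) set" where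
  "SL2 = {g. det g = 1}"

definition SU2 :: "(complex^2^2) set" where
  "SU2 = {g \<in> SL2. map_matrix cnj (transpose g) ** g = mat 1}"

definition form_act :: "complex^2^2 \<Rightarrow> (complex^2 \<Rightarrow> complex) \<Rightarrow> complex^2 \<Rightarrow> complex" where
  "form_act g F z = F (matrix_inv g *v z)"

definition veronese :: "complex^2 \<Rightarrow> complex^3" where
  "veronese z = vector [(z$1)^2 - (z$2)^2, \<i> * ((z$1)^2 + (z$2)^2), 2 * z$1 * z$2]"

definition Psi :: "(complex^3 \<Rightarrow> complex) \<Rightarrow> complex^2 \<Rightarrow> complex" where
  "Psi f = f \<circ> veronese"

definition cdot :: "complex^3 \<Rightarrow> complex^3 \<Rightarrow> complex" where
  "cdot x y = (\<Sum>i\<in>UNIV. x$i * y$i)"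

definition Qform :: "complex^3 \<Rightarrow> complex^2 \<Rightarrow> complex" where
  "Qform x z = cdot x (veronese z)"

definition complexify :: "real^3 \<Rightarrow> complex^3" where
  "complexify a = (\<chi> i. complex_of_real (a$i))"

definition cline :: "complex^2 \<Rightarrow> (complex^2) set" where
  "cline w = range (\<lambda>c. c *s w)"

definition CP1 :: "(complex^2) set set" where
  "CP1 = cline ` {w. w \<noteq> 0}"

definition jmap :: "complex^2 \<Rightarrow> complex^2" where
  "jmap z = vector [- cnj (z$2), cnj (z$1)]"

(* For a point [w] the image of the line of w under the antilinear map j is the line of j w. *)
definition antipode :: "(complex^2) set \<Rightarrow> (complex^2) set" where
  "antipode p = jmap ` p"

(* The multiplicity at [w] of a nonzero form F of degree n is the exponent in F of the linear form
   w_0 z_1 - w_1 z_0 vanishing at [w]; the choice of w only rescales this linear form. *)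
definition root_divisor :: "nat \<Rightarrow> (complex^2 \<Rightarrow> complex) \<Rightarrow> (complex^2) set \<Rightarrow> nat" where
  "root_divisor n F p = (GREATEST k. k \<le> n \<and>
     (\<exists>w\<in>p. w \<noteq> 0 \<and> (\<exists>G\<in>Sym (n - k). \<forall>z. F z = (w$1 * z$2 - w$2 * z$1)^k * G z)))"

definition antipodal_invariant :: "((complex^2) set \<Rightarrow> nat) \<Rightarrow> bool" where
  "antipodal_invariant D \<longleftrightarrow> (\<forall>p\<in>CP1. D (antipode p) = D p)"

definition complex_subspace :: "('a \<Rightarrow> complex) set \<Rightarrow> bool" where
  "complex_subspace W \<longleftrightarrow> (\<lambda>z. 0) \<in> W \<and> (\<forall>F\<in>W. \<forall>G\<in>W. (\<lambda>z. F z + G z) \<in> W) \<and>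
     (\<forall>c. \<forall>F\<in>W. (\<lambda>z. c * F z) \<in> W)"

definition real_structure ::
    "('a \<Rightarrow> complex) set \<Rightarrow> (('a \<Rightarrow> complex) \<Rightarrow> 'a \<Rightarrow> complex) \<Rightarrow> bool" where
  "real_structure W s \<longleftrightarrow> complex_subspace W \<and> (\<forall>F\<in>W. s F \<in> W) \<and>
     (\<forall>F\<in>W. \<forall>G\<in>W. s (\<lambda>z. F z + G z) = (\<lambda>z. s F z + s G z)) \<and>
     (\<forall>c. \<forall>F\<in>W. s (\<lambda>z. c * F z) = (\<lambda>z. cnj c * s F z)) \<and>
     (\<forall>F\<in>W. s (s F) = F)"

definition Fix :: "('a \<Rightarrow> complex) set \<Rightarrow> (('a \<Rightarrow> complex) \<Rightarrow> 'a \<Rightarrow> complex) \<Rightarrow> ('a \<Rightarrow> complex) set" where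
  "Fix W s = {F \<in> W. s F = F}"

definition sigma_conj :: "nat \<Rightarrow> (complex^2 \<Rightarrow> complex) \<Rightarrow> complex^2 \<Rightarrow> complex" where
  "sigma_conj l F z = (-1)^l * cnj (F (jmap z))"

type_synonym form_system = "nat \<Rightarrow> complex^2 \<Rightarrow> complex"

(* The direct sum of the spaces Sym (2 l), l \<le> L: families that vanish beyond L. *)
definition form_space :: "nat \<Rightarrow> form_system set" where
  "form_space L = {F. (\<forall>l\<le>L. F l \<in> Sym (2 * l)) \<and> (\<forall>l>L. F l = (\<lambda>z. 0))}"

definition forms_of_coeffs :: "nat \<Rightarrow> (nat \<Rightarrow> nat \<Rightarrow> complex) \<Rightarrow> form_system" where
  "forms_of_coeffs L a l = (if l \<le> L then binary_form (2 * l) (a l) else (\<lambda>z. 0))"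

(* Polynomial functions on form_space L whose coefficients, as polynomials in the normalised
   coefficients a l k of the forms, lie in K. They are extended by 0 off form_space L, so that
   equality of such functions is equality on form_space L. *)
definition poly_functions :: "complex set \<Rightarrow> nat \<Rightarrow> (form_system \<Rightarrow> complex) set" where
  "poly_functions K L = {I. (\<forall>F. F \<notin> form_space L \<longrightarrow> I F = 0) \<and>
     (\<exists>(M :: (nat \<Rightarrow> nat \<Rightarrow> nat) set) c. finite M \<and> (\<forall>m\<in>M. c m \<in> K) \<and>
        (\<forall>a. I (forms_of_coeffs L a) = (\<Sum>m\<in>M. c m * (\<Prod>l\<le>L. \<Prod>k\<le>2 * l. a l k ^ m l k))))}"

definition invariants :: "nat \<Rightarrow> (form_system \<Rightarrow> complex) set" where
  "invariants L = {I \<in> poly_functions UNIV L.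
     \<forall>g\<in>SL2. \<forall>F\<in>form_space L. I (\<lambda>l. form_act g (F l)) = I F}"

definition real_coeffs :: "nat \<Rightarrow> (form_system \<Rightarrow> complex) \<Rightarrow> bool" where
  "real_coeffs L I \<longleftrightarrow> I \<in> poly_functions \<real> L"

definition multihomogeneous :: "nat \<Rightarrow> (nat \<Rightarrow> nat) \<Rightarrow> (form_system \<Rightarrow> complex) \<Rightarrow> bool" where
  "multihomogeneous L d I \<longleftrightarrow>
     (\<forall>t :: nat \<Rightarrow> complex. \<forall>F\<in>form_space L. I (\<lambda>l z. t l * F l z) = (\<Prod>l\<le>L. t l ^ d l) * I F)"

definition weight :: "nat \<Rightarrow> (nat \<Rightarrow> nat) \<Rightarrow> nat" where
  "weight L d = (\<Sum>l\<le>L. l * d l)"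

(* C d is the component of I of multidegree d. Multidegrees are normalised to vanish beyond L. *)
definition is_mh_components ::
    "nat \<Rightarrow> (form_system \<Rightarrow> complex) \<Rightarrow> ((nat \<Rightarrow> nat) \<Rightarrow> form_system \<Rightarrow> complex) \<Rightarrow> bool" where
  "is_mh_components L I C \<longleftrightarrow>
     (\<forall>d. C d \<in> poly_functions UNIV L \<and> multihomogeneous L d (C d)) \<and>
     finite {d. C d \<noteq> (\<lambda>F. 0)} \<and>
     (\<forall>d. C d \<noteq> (\<lambda>F. 0) \<longrightarrow> (\<forall>l>L. d l = 0)) \<and>
     (\<forall>F. I F = (\<Sum>d | C d \<noteq> (\<lambda>F. 0). C d F))"

definition mh_components ::
    "nat \<Rightarrow> (form_system \<Rightarrow> complex) \<Rightarrow> (nat \<Rightarrow> nat) \<Rightarrow> form_system \<Rightarrow> complex" where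
  "mh_components L I = (THE C. is_mh_components L I C)"

definition even_part :: "nat \<Rightarrow> (form_system \<Rightarrow> complex) \<Rightarrow> form_system \<Rightarrow> complex" where
  "even_part L I F =
     (\<Sum>d | mh_components L I d \<noteq> (\<lambda>F. 0) \<and> even (weight L d). mh_components L I d F)"

definition odd_part :: "nat \<Rightarrow> (form_system \<Rightarrow> complex) \<Rightarrow> form_system \<Rightarrow> complex" where
  "odd_part L I F =
     (\<Sum>d | mh_components L I d \<noteq> (\<lambda>F. 0) \<and> odd (weight L d). mh_components L I d F)"

definition even_invariants :: "nat \<Rightarrow> (form_system \<Rightarrow> complex) set" where
  "even_invariants L = {I \<in> invariants L. even_part L I = I}"

definition odd_invariants :: "nat \<Rightarrow> (form_system \<Rightarrow> complex) set" where
  "odd_invariants L = {I \<in> invariants L. odd_part L I = I}"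

definition Psi_system :: "nat \<Rightarrow> (nat \<Rightarrow> complex^3 \<Rightarrow> complex) \<Rightarrow> form_system" where
  "Psi_system L f l = (if l \<le> L then Psi (f l) else (\<lambda>z. 0))"

end

theory Submission
  imports Defs "HOL-Computational_Algebra.Fundamental_Theorem_Algebra"
begin

text \<open>
  (i) With \<open>\<langle>v(w), v(z)\<rangle> = -2 (w\<^sub>0 z\<^sub>1 - w\<^sub>1 z\<^sub>0)\<^sup>2\<close>, the harmonic \<open>l\<close>-th power of the linear
  form with isotropic coefficient vector \<open>v(w)\<close> is sent by \<open>\<Psi>\<^sub>l\<close> to a multiple of the \<open>2l\<close>-th power
  of the linear form vanishing at \<open>w\<close>, and such powers span the binary forms. A preimage of a fixed
  form is made real by averaging it with its conjugate.

  (ii) If the root divisor is antipodally symmetric, a root \<open>w\<close> comes with \<open>j w\<close>, and the product of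
  the two linear forms is \<open>Q\<^sub>a\<close> with \<open>a\<close> real; removing it keeps the symmetry. Conversely \<open>Q\<^sub>a\<close> is
  determined up to a real factor by one of its roots, which gives uniqueness by cancellation.

  (iii) On \<open>\<sigma>\<^sub>l\<close>-fixed forms, conjugating the coefficients is the action of
  \<open>(z\<^sub>0, z\<^sub>1) \<mapsto> (-z\<^sub>1, z\<^sub>0)\<close> up to the sign \<open>(-1)\<^sup>l\<close>.

  (iv) Every orthogonal matrix is a product of reflections, and a reflection in a unit vector \<open>n\<close> sends
  \<open>v(z)\<close> to \<open>- v(g z)\<close> for an explicit \<open>g \<in> SL\<^sub>2\<close>. The multihomogeneous components of an
  invariant are recovered from its values on rescaled arguments, hence are themselves invariant.
\<close>

section \<open>Binary forms and linear factors\<close>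

lemma Sym_iff: "F \<in> Sym n \<longleftrightarrow> (\<exists>b. \<forall>z. F z = (\<Sum>k\<le>n. b k * (z$1)^(n - k) * (z$2)^k))"
proof
  assume "F \<in> Sym n"
  then obtain a where "F = binary_form n a"
    by (auto simp: Sym_def)
  then show "\<exists>b. \<forall>z. F z = (\<Sum>k\<le>n. b k * (z$1)^(n - k) * (z$2)^k)"
    by (intro exI[of _ "\<lambda>k. of_nat (n choose k) * a k"]) (simp add: binary_form_def)
next
  assume "\<exists>b. \<forall>z. F z = (\<Sum>k\<le>n. b k * (z$1)^(n - k) * (z$2)^k)"
  then obtain b where b: "\<And>z. F z = (\<Sum>k\<le>n. b k * (z$1)^(n - k) * (z$2)^k)"
    by blast
  \<comment> \<open>Undoing the binomial normalisation is legitimate because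
    \<open>n choose k\<close> is nonzero for \<open>k \<le> n\<close>.\<close>
  have "F = binary_form n (\<lambda>k. b k / of_nat (n choose k))"
    unfolding fun_eq_iff binary_form_def b
    by (auto intro!: sum.cong)
  then show "F \<in> Sym n"
    by (auto simp: Sym_def)
qed

lemma Sym_zero: "(\<lambda>z. 0) \<in> Sym n"
  unfolding Sym_iff by (rule exI[of _ "\<lambda>k. 0"]) simp

lemma Sym_add:
  assumes "F \<in> Sym n" "G \<in> Sym n"
  shows "(\<lambda>z. F z + G z) \<in> Sym n"
proof -
  obtain b c where "\<And>z. F z = (\<Sum>k\<le>n. b k * (z$1)^(n - k) * (z$2)^k)"
    "\<And>z. G z = (\<Sum>k\<le>n. c k * (z$1)^(n - k) * (z$2)^k)"
    using assms unfolding Sym_iff by blast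
  then show ?thesis
    unfolding Sym_iff
    by (intro exI[of _ "\<lambda>k. b k + c k"]) (simp add: sum.distrib algebra_simps)
qed

lemma Sym_cmult:
  assumes "F \<in> Sym n"
  shows "(\<lambda>z. c * F z) \<in> Sym n"
proof -
  obtain b where "\<And>z. F z = (\<Sum>k\<le>n. b k * (z$1)^(n - k) * (z$2)^k)"
    using assms unfolding Sym_iff by blast
  then show ?thesis
    unfolding Sym_iff
    by (intro exI[of _ "\<lambda>k. c * b k"]) (simp add: sum_distrib_left algebra_simps)
qed

lemma Sym_sum:
  assumes "\<And>i. i \<in> S \<Longrightarrow> F i \<in> Sym n"
  shows "(\<lambda>z. \<Sum>i\<in>S. F i z) \<in> Sym n"
  using assms
proof (induction S rule: infinite_finite_induct)
  case (insert x S)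
  then have "(\<lambda>z. F x z + (\<Sum>i\<in>S. F i z)) \<in> Sym n"
    by (intro Sym_add) auto
  then show ?case
    using insert.hyps by simp
qed (simp_all add: Sym_zero)

lemma Sym_monom: "(\<lambda>z. (z$1)^i * (z$2)^j) \<in> Sym (i + j)"
  unfolding Sym_iff
proof (intro exI[of _ "\<lambda>k. if k = j then 1 else 0"] allI)
  fix z :: "complex^2"
  have "(\<Sum>k\<le>i + j. (if k = j then 1 else 0) * z $ 1 ^ (i + j - k) * z $ 2 ^ k)
     = (\<Sum>k\<le>i + j. if k = j then z $ 1 ^ (i + j - k) * z $ 2 ^ k else 0)"
    by (intro sum.cong) auto
  then show "z $ 1 ^ i * z $ 2 ^ j = (\<Sum>k\<le>i + j. (if k = j then 1 else 0) * z $ 1 ^ (i + j - k) * z $ 2 ^ k)"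
    by (simp add: sum.delta)
qed

lemma Sym_mult:
  assumes "F \<in> Sym m" "G \<in> Sym n"
  shows "(\<lambda>z. F z * G z) \<in> Sym (m + n)"
proof -
  obtain b c where b: "\<And>z. F z = (\<Sum>k\<le>m. b k * (z$1)^(m - k) * (z$2)^k)"
    and c: "\<And>z. G z = (\<Sum>k\<le>n. c k * (z$1)^(n - k) * (z$2)^k)"
    using assms unfolding Sym_iff by blast
  have "(\<lambda>z. F z * G z) = (\<lambda>z. \<Sum>i\<le>m. \<Sum>j\<le>n. (b i * c j) * ((z$1)^((m - i) + (n - j)) * (z$2)^(i + j)))"
    unfolding b c sum_product by (simp only: power_add mult.assoc mult.commute mult.left_commute)
  moreover have "(\<lambda>z :: complex^2. (z$1)^((m - i) + (n - j)) * (z$2)^(i + j)) \<in> Sym (m + n)"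
    if "i \<le> m" "j \<le> n" for i j
    using Sym_monom[of "(m - i) + (n - j)" "i + j"] that by simp
  ultimately show ?thesis
    by (auto intro!: Sym_sum Sym_cmult)
qed

lemma Sym_const: "(\<lambda>z. c) \<in> Sym 0"
  using Sym_cmult[OF Sym_monom[of 0 0], of c] by simp

lemma Sym_power:
  assumes "F \<in> Sym n"
  shows "(\<lambda>z. F z ^ k) \<in> Sym (n * k)"
proof (induction k)
  case (Suc k)
  show ?case
    using Sym_mult[OF assms Suc] by simp
qed (simp add: Sym_const)

lemma Sym_prod_list:
  assumes "\<And>a. a \<in> set as \<Longrightarrow> G a \<in> Sym n"
  shows "(\<lambda>z. \<Prod>a\<leftarrow>as. G a z) \<in> Sym (n * length as)"
  using assms
proof (induction as)
  case (Cons a as)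
  then have "(\<lambda>z. G a z * (\<Prod>a\<leftarrow>as. G a z)) \<in> Sym (n + n * length as)"
    by (intro Sym_mult) auto
  then show ?case by simp
qed (simp add: Sym_const)

lemma Sym_lin: "(\<lambda>z. a * z$1 + b * z$2) \<in> Sym 1"
  using Sym_add[of "\<lambda>z. a * z$1" 1 "\<lambda>z. b * z$2"] Sym_cmult[of "\<lambda>z. z$1" 1 a]
    Sym_cmult[of "\<lambda>z. z$2" 1 b] Sym_monom[of 1 0] Sym_monom[of 0 1]
  by simp

text \<open>The one closure property behind the group action, the change of coordinates in
  \<open>Sym_factor\<close> and the pullback along \<open>jmap\<close>.\<close>

lemma Sym_subst:
  assumes "F \<in> Sym n"
  shows "(\<lambda>z. F (vector [a * z$1 + b * z$2, c * z$1 + d * z$2])) \<in> Sym n"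
proof -
  obtain e where e: "\<And>z. F z = (\<Sum>k\<le>n. e k * (z$1)^(n - k) * (z$2)^k)"
    using assms unfolding Sym_iff by blast
  have "(\<lambda>z. e k * ((a * z$1 + b * z$2)^(n - k) * (c * z$1 + d * z$2)^k)) \<in> Sym n" if "k \<le> n" for k
    using Sym_cmult[OF Sym_mult[OF Sym_power[OF Sym_lin[of a b], of "n - k"]
          Sym_power[OF Sym_lin[of c d], of k]], of "e k"] that
    by simp
  then show ?thesis
    unfolding e vector_2 by (intro Sym_sum) (simp add: mult.assoc)
qed

lemma Sym_homogeneous:
  assumes "F \<in> Sym n"
  shows "F (c *s z) = c ^ n * F z"
proof -
  obtain e where e: "\<And>z. F z = (\<Sum>k\<le>n. e k * (z$1)^(n - k) * (z$2)^k)"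
    using assms unfolding Sym_iff by blast
  have "c ^ (n - k) * c ^ k = c ^ n" if "k \<le> n" for k
    using that by (simp flip: power_add)
  then show ?thesis
    unfolding e sum_distrib_left
    by (intro sum.cong) (auto simp: power_mult_distrib algebra_simps)
qed

lemma Sym_continuous:
  assumes "F \<in> Sym n"
  shows "continuous_on UNIV F"
proof -
  obtain e where e: "\<And>z. F z = (\<Sum>k\<le>n. e k * (z$1)^(n - k) * (z$2)^k)"
    using assms unfolding Sym_iff by blast
  then have "F = (\<lambda>z. \<Sum>k\<le>n. e k * (z$1)^(n - k) * (z$2)^k)"
    by blast
  then show ?thesis
    by (auto intro!: continuous_intros)
qed

text \<open>Setting the first coordinate to 1 reduces this to uniqueness of the coefficients of a
  polynomial in one variable; the binomial factors are then cancelled.\<close>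

lemma binary_form_inject:
  assumes "binary_form n a = binary_form n b" "k \<le> n"
  shows "a k = b k"
proof -
  have "(\<Sum>k\<le>n. (of_nat (n choose k) * a k) * t^k) = (\<Sum>k\<le>n. (of_nat (n choose k) * b k) * t^k)" for t
    using fun_cong[OF assms(1), of "vector [1, t]"] by (simp add: binary_form_def)
  then have "of_nat (n choose k) * a k = of_nat (n choose k) * b k"
    using polyfun_eq_coeffs[of "\<lambda>k. of_nat (n choose k) * a k" n "\<lambda>k. of_nat (n choose k) * b k"]
      assms(2) by blast
  then show ?thesis
    using assms(2) by simp
qed

section \<open>Linear forms vanishing at a point, and roots of binary forms\<close>

definition lin :: "complex^2 \<Rightarrow> complex^2 \<Rightarrow> complex" where
  "lin w z = w$1 * z$2 - w$2 * z$1"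

lemma lin_Sym: "lin w \<in> Sym 1"
  using Sym_lin[of "- w$2" "w$1"] by (simp add: lin_def[abs_def] algebra_simps)

lemma lin_self [simp]: "lin w w = 0"
  by (simp add: lin_def)

lemma lin_scale: "lin (c *s w) z = c * lin w z"
  by (simp add: lin_def algebra_simps)

lemma lin_eq_0_iff:
  assumes "w \<noteq> 0"
  shows "lin w z = 0 \<longleftrightarrow> z \<in> cline w"
proof
  assume z: "lin w z = 0"
  show "z \<in> cline w"
  proof (cases "w$1 = 0")
    case True
    then have "w$2 \<noteq> 0"
      using assms by (auto simp: vec_eq_iff forall_2)
    then have "z = (z$2 / w$2) *s w"
      using z True by (auto simp: vec_eq_iff forall_2 lin_def)
    then show ?thesis
      by (auto simp: cline_def)
  next
    case False
    then have "z = (z$1 / w$1) *s w"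
      using z by (auto simp: vec_eq_iff forall_2 lin_def field_simps)
    then show ?thesis
      by (auto simp: cline_def)
  qed
qed (auto simp: cline_def lin_def)

lemma ex_lin_nonzero:
  assumes "w \<noteq> 0"
  shows "\<exists>e. lin w e \<noteq> 0"
proof -
  have "lin w (vector [0, 1]) \<noteq> 0 \<or> lin w (vector [1, 0]) \<noteq> 0"
    using assms by (auto simp: lin_def vec_eq_iff forall_2)
  then show ?thesis by blast
qed

text \<open>Off the line of \<open>w\<close> one divides by \<open>lin w z\<close>. A point on that
  line is approached along a direction \<open>e\<close> with \<open>lin w e \<noteq> 0\<close>, and
  both forms are continuous.\<close>

lemma lin_mult_cancel:
  assumes w: "w \<noteq> 0" and F: "F \<in> Sym m" and G: "G \<in> Sym n"
    and eq: "\<And>z. lin w z * F z = lin w z * G z"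
  shows "F = G"
proof
  fix z
  show "F z = G z"
  proof (cases "lin w z = 0")
    case True
    obtain e where e: "lin w e \<noteq> 0"
      using ex_lin_nonzero[OF w] by blast
    have FG: "F (z + t *s e) = G (z + t *s e)" if "t \<noteq> 0" for t
    proof -
      have "lin w (z + t *s e) = t * lin w e"
        using True by (simp add: lin_def algebra_simps)
      then show ?thesis
        using eq[of "z + t *s e"] e that by simp
    qed
    have cont: "((\<lambda>t. z + t *s e) \<longlongrightarrow> z) (at 0)"
      unfolding vector_scalar_mult_def
      by (rule vec_tendstoI) (auto intro!: tendsto_eq_intros)
    have "((\<lambda>t. F (z + t *s e)) \<longlongrightarrow> F z) (at 0)" "((\<lambda>t. G (z + t *s e)) \<longlongrightarrow> G z) (at 0)"
      using Sym_continuous[OF F] Sym_continuous[OF G] cont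
      by (auto intro!: isCont_tendsto_compose[OF _ cont] simp: continuous_on_eq_continuous_at)
    moreover have "\<forall>\<^sub>F t in at 0. G (z + t *s e) = F (z + t *s e)"
      using FG by (auto simp: eventually_at_filter)
    ultimately show ?thesis
      by (intro tendsto_unique[OF at_neq_bot _ Lim_transform_eventually])
  qed (use eq[of z] in auto)
qed

text \<open>In coordinates where \<open>w\<close> becomes the first basis vector, vanishing at
  \<open>w\<close> kills the coefficient of the pure power of the first coordinate, so the second
  coordinate divides the form. Changing back turns that coordinate into a multiple of
  \<open>lin w\<close>.\<close>

lemma Sym_factor:
  assumes w: "w \<noteq> 0" and F: "F \<in> Sym (Suc n)" and root: "F w = 0"
  obtains G where "G \<in> Sym n" "\<And>z. F z = lin w z * G z"
proof -
  \<comment> \<open>This squared norm of \<open>w\<close> is the determinant of the substitution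
    defining \<open>H\<close>, whose columns are \<open>w\<close> and \<open>jmap w\<close>.\<close>
  define N where "N = w$1 * cnj (w$1) + w$2 * cnj (w$2)"
  have "N = of_real ((cmod (w$1))\<^sup>2 + (cmod (w$2))\<^sup>2)"
    by (simp only: N_def of_real_add complex_norm_square)
  moreover have "(cmod (w$1))\<^sup>2 + (cmod (w$2))\<^sup>2 \<noteq> 0"
    using w by (auto simp: vec_eq_iff forall_2 sum_power2_eq_zero_iff)
  ultimately have N: "N \<noteq> 0"
    by (metis of_real_eq_0_iff)
  define H where "H = (\<lambda>z :: complex^2. F (vector [w$1 * z$1 + (- cnj (w$2)) * z$2, w$2 * z$1 + cnj (w$1) * z$2]))"
  have "H \<in> Sym (Suc n)"
    unfolding H_def by (rule Sym_subst[OF F])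
  then obtain b where b: "\<And>z. H z = (\<Sum>k\<le>Suc n. b k * (z$1)^(Suc n - k) * (z$2)^k)"
    unfolding Sym_iff by blast
  have "H (vector [1, 0]) = F w"
    unfolding H_def by (rule arg_cong[of _ _ F]) (simp add: vec_eq_iff forall_2)
  moreover have "H (vector [1, 0]) = b 0"
    unfolding b by (subst sum.remove[of _ 0]) (auto intro!: sum.neutral)
  ultimately have b0: "b 0 = 0"
    using root by simp
  define K where "K = (\<lambda>z :: complex^2. \<Sum>k\<le>n. b (Suc k) * (z$1)^(n - k) * (z$2)^k)"
  have K: "K \<in> Sym n"
    unfolding Sym_iff K_def by (rule exI[of _ "\<lambda>k. b (Suc k)"]) simp
  have HK: "H z = z$2 * K z" for z
    unfolding b K_def sum.atMost_Suc_shift by (simp add: b0 sum_distrib_left algebra_simps)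
  define G where "G = (\<lambda>z :: complex^2. inverse N * K (vector [cnj (w$1) / N * z$1 + cnj (w$2) / N * z$2, (- w$2 / N) * z$1 + w$1 / N * z$2]))"
  have "G \<in> Sym n"
    unfolding G_def by (intro Sym_cmult Sym_subst K)
  moreover have "F z = lin w z * G z" for z
  proof -
    \<comment> \<open>The preimage of \<open>z\<close> under the substitution of \<open>H\<close>;
      its second coordinate is \<open>lin w z\<close> divided by \<open>N\<close>.\<close>
    let ?y = "vector [cnj (w$1) / N * z$1 + cnj (w$2) / N * z$2, (- w$2 / N) * z$1 + w$1 / N * z$2] :: complex^2"
    have "w $ 1 * (cnj (w$1) / N * z$1 + cnj (w$2) / N * z$2) + (- cnj (w$2)) * ((- w$2 / N) * z$1 + w$1 / N * z$2) = N * z$1 / N"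
      "w $ 2 * (cnj (w$1) / N * z$1 + cnj (w$2) / N * z$2) + cnj (w$1) * ((- w$2 / N) * z$1 + w$1 / N * z$2) = N * z$2 / N"
      unfolding N_def by (simp_all add: divide_simps) (simp_all add: algebra_simps)
    then have "H ?y = F z"
      unfolding H_def using N by (intro arg_cong[of _ _ F]) (simp add: vec_eq_iff forall_2)
    moreover have "?y $ 2 = lin w z * inverse N"
      using N by (simp add: lin_def field_simps)
    ultimately have "F z = lin w z * inverse N * K ?y"
      using HK[of ?y] by metis
    then show ?thesis
      by (simp only: G_def mult.assoc)
  qed
  ultimately show thesis
    using that by blast
qed

lemma Sym_0_root:
  assumes "F \<in> Sym 0" "F w = 0"
  shows "F = (\<lambda>z. 0)"
  using assms unfolding Sym_iff by auto

text \<open>If the coefficient of the pure power of the second coordinate vanishes, the point at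
  infinity \<open>[0, 1]\<close> is a root. Otherwise the dehomogenised polynomial is not constant
  and has a complex zero.\<close>

lemma Sym_has_root:
  assumes F: "F \<in> Sym (Suc n)"
  obtains w where "w \<noteq> 0" "F w = 0"
proof -
  obtain b where b: "\<And>z. F z = (\<Sum>k\<le>Suc n. b k * (z$1)^(Suc n - k) * (z$2)^k)"
    using F unfolding Sym_iff by blast
  show thesis
  proof (cases "b (Suc n) = 0")
    case True
    have "F (vector [0, 1]) = 0"
      unfolding b by (rule sum.neutral) (use True in \<open>auto simp: le_Suc_eq power_0_left\<close>)
    then show thesis
      by (intro that[of "vector [0, 1]"]) (auto simp: vec_eq_iff forall_2)
  next
    case False
    define p where "p = (\<Sum>k\<le>Suc n. monom (b k) k)"
    have "coeff p (Suc n) = b (Suc n)"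
      unfolding p_def by (simp add: coeff_sum)
    then have "degree p \<noteq> 0"
      using False le_degree[of p "Suc n"] by auto
    then obtain t where "poly p t = 0"
      using fundamental_theorem_of_algebra[of p] by (auto simp: constant_degree)
    then have "F (vector [1, t]) = 0"
      unfolding b p_def by (simp add: poly_sum poly_monom)
    then show thesis
      by (intro that[of "vector [1, t]"]) (auto simp: vec_eq_iff forall_2)
  qed
qed

section \<open>Real structures and harmonic polynomials\<close>

lemma matrix_inv_eqI:
  fixes A :: "'a::field^'n^'n"
  assumes "A ** B = mat 1"
  shows "matrix_inv A = B"
proof -
  have BA: "B ** A = mat 1"
    using assms matrix_left_right_inverse by blast
  then have "A ** matrix_inv A = mat 1 \<and> matrix_inv A ** A = mat 1"
    unfolding matrix_inv_def using assms someI[of "\<lambda>B. A ** B = mat 1 \<and> B ** A = mat 1" B] by blast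
  then have "matrix_inv A = (B ** A) ** matrix_inv A" "B ** (A ** matrix_inv A) = B"
    by (simp_all add: BA)
  then show ?thesis
    by (simp add: matrix_mul_assoc)
qed

lemma matrix_inv_SL2:
  assumes "g \<in> SL2"
  shows "matrix_inv g = vector [vector [g$2$2, - (g$1$2)], vector [- (g$2$1), g$1$1]]"
  using assms
  by (intro matrix_inv_eqI)
    (auto simp: SL2_def det_2 vec_eq_iff forall_2 matrix_matrix_mult_def sum_2 mat_def algebra_simps)

lemma form_act_SL2:
  assumes "g \<in> SL2"
  shows "form_act g F z = F (vector [g$2$2 * z$1 - g$1$2 * z$2, g$1$1 * z$2 - g$2$1 * z$1])"
proof -
  have "matrix_inv g *v z = vector [g$2$2 * z$1 - g$1$2 * z$2, g$1$1 * z$2 - g$2$1 * z$1]"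
    by (simp add: matrix_inv_SL2[OF assms] vec_eq_iff forall_2 matrix_vector_mult_def sum_2)
  then show ?thesis
    by (simp add: form_act_def)
qed

text \<open>Unitarity makes the adjoint the inverse, which determinant 1 identifies with the
  adjugate; the entries are compared.\<close>

lemma SU2_entries:
  assumes "g \<in> SU2"
  shows "cnj (g$1$1) = g$2$2" "cnj (g$2$2) = g$1$1" "cnj (g$1$2) = - g$2$1" "cnj (g$2$1) = - g$1$2"
proof -
  have "g ** map_matrix cnj (transpose g) = mat 1" "g \<in> SL2"
    using assms matrix_left_right_inverse by (auto simp: SU2_def)
  then have "map_matrix cnj (transpose g) = vector [vector [g$2$2, - (g$1$2)], vector [- (g$2$1), g$1$1]]"
    using matrix_inv_eqI matrix_inv_SL2 by metis
  then show "cnj (g$1$1) = g$2$2" "cnj (g$2$2) = g$1$1" "cnj (g$1$2) = - g$2$1" "cnj (g$2$1) = - g$1$2"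
    by (simp_all add: vec_eq_iff forall_2 transpose_def)
qed

lemma Sym_form_act:
  assumes "g \<in> SL2" "F \<in> Sym n"
  shows "form_act g F \<in> Sym n"
proof -
  have "form_act g F = (\<lambda>z. F (vector [g$2$2 * z$1 + (- g$1$2) * z$2, (- g$2$1) * z$1 + g$1$1 * z$2]))"
    unfolding fun_eq_iff form_act_SL2[OF assms(1)] by simp
  then show ?thesis
    by (simp only: Sym_subst[OF assms(2)])
qed

lemma jmap_component [simp]: "jmap z $ 1 = - cnj (z$2)" "jmap z $ 2 = cnj (z$1)"
  by (simp_all add: jmap_def)

lemma jmap_jmap: "jmap (jmap z) = (-1) *s z"
  by (simp add: vec_eq_iff forall_2)

lemma jmap_scale: "jmap (c *s z) = cnj c *s jmap z"
  by (simp add: vec_eq_iff forall_2)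

lemma jmap_eq_0_iff [simp]: "jmap z = 0 \<longleftrightarrow> z = 0"
  by (auto simp: vec_eq_iff forall_2)

lemma veronese_component [simp]:
  "veronese z $ 1 = (z$1)^2 - (z$2)^2"
  "veronese z $ 2 = \<i> * ((z$1)^2 + (z$2)^2)"
  "veronese z $ 3 = 2 * z$1 * z$2"
  by (simp_all add: veronese_def)

lemma cnj_vec_component [simp]: "cnj_vec x $ i = cnj (x $ i)"
  by (simp add: cnj_vec_def)

text \<open>On the isotropic cone \<open>jmap\<close> becomes minus complex conjugation. This minus
  sign is the source of the factor \<open>(-1)^l\<close> in \<open>sigma_conj\<close>.\<close>

lemma veronese_jmap: "veronese (jmap z) = (-1) *s cnj_vec (veronese z)"
  by (simp add: vec_eq_iff forall_3 algebra_simps)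

lemma Sym_cnj:
  assumes "F \<in> Sym n"
  shows "(\<lambda>z. cnj (F (cnj_vec z))) \<in> Sym n"
proof -
  obtain b where b: "\<And>z. F z = (\<Sum>k\<le>n. b k * (z$1)^(n - k) * (z$2)^k)"
    using assms unfolding Sym_iff by blast
  show ?thesis
    unfolding Sym_iff b by (rule exI[of _ "\<lambda>k. cnj (b k)"]) simp
qed

text \<open>\<open>jmap\<close> is a linear substitution followed by conjugation of the coordinates,
  so the two previous kinds of closure combine.\<close>

lemma Sym_jmap:
  assumes "F \<in> Sym n"
  shows "(\<lambda>z. cnj (F (jmap z))) \<in> Sym n"
proof -
  have "cnj_vec (vector [0 * z$1 + (-1) * z$2, 1 * z$1 + 0 * z$2]) = jmap z" for z
    by (simp add: vec_eq_iff forall_2)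
  then show ?thesis
    using Sym_subst[OF Sym_cnj[OF assms], of 0 "-1" 1 0] by simp
qed

lemma Sym_sigma_conj: "F \<in> Sym n \<Longrightarrow> sigma_conj l F \<in> Sym n"
  unfolding sigma_conj_def[abs_def] by (intro Sym_cmult Sym_jmap)

lemma sigma_conj_scale: "sigma_conj l (\<lambda>z. c * F z) = (\<lambda>z. cnj c * sigma_conj l F z)"
  by (auto simp: sigma_conj_def)

text \<open>\<open>jmap\<close> squares to -1, which forms of even degree do not see; the two signs
  cancel.\<close>

lemma sigma_conj_sigma_conj:
  assumes "F \<in> Sym (2 * l)"
  shows "sigma_conj l (sigma_conj l F) = F"
proof
  fix z
  have "F (jmap (jmap z)) = F z"
    unfolding jmap_jmap Sym_homogeneous[OF assms] by simp
  then show "sigma_conj l (sigma_conj l F) z = F z"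
    by (simp add: sigma_conj_def flip: mult.assoc power_mult_distrib)
qed

lemma real_structure_sigma_conj: "real_structure (Sym (2 * l)) (sigma_conj l)"
  unfolding real_structure_def complex_subspace_def
  by (auto simp: Sym_zero Sym_add Sym_cmult Sym_sigma_conj sigma_conj_scale sigma_conj_sigma_conj)
    (auto simp: sigma_conj_def algebra_simps)

text \<open>The relations between the entries of a special unitary matrix say exactly that it
  commutes with \<open>jmap\<close>.\<close>

lemma sigma_conj_form_act:
  assumes "g \<in> SU2"
  shows "sigma_conj l (form_act g F) = form_act g (sigma_conj l F)"
proof -
  have g: "g \<in> SL2"
    using assms by (simp add: SU2_def)
  have "vector [g$2$2 * jmap z$1 - g$1$2 * jmap z$2, g$1$1 * jmap z$2 - g$2$1 * jmap z$1] =
    jmap (vector [g$2$2 * z$1 - g$1$2 * z$2, g$1$1 * z$2 - g$2$1 * z$1])" for z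
    by (simp add: vec_eq_iff forall_2 SU2_entries[OF assms] algebra_simps)
  then show ?thesis
    unfolding fun_eq_iff sigma_conj_def form_act_SL2[OF g] by simp
qed

section \<open>Harmonic polynomials and surjectivity of \<open>Psi\<close>\<close>

lemma hom_poly3_scale: "hom_poly3 l c (t *s x) = t ^ l * hom_poly3 l c x"
proof -
  have "t ^ p * (t ^ q * t ^ (l - p - q)) = t ^ l" if "p \<le> l" "q \<le> l - p" for p q
    using that by (simp flip: power_add)
  then show ?thesis
    unfolding hom_poly3_def sum_distrib_left
    by (intro sum.cong) (auto simp: power_mult_distrib mult_ac)
qed

lemma conj_poly_hom_poly3: "conj_poly (hom_poly3 l c) = hom_poly3 l (\<lambda>p q. cnj (c p q))"
  by (simp add: fun_eq_iff conj_poly_def hom_poly3_def)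

lemma hom_poly3_add: "hom_poly3 l c x + hom_poly3 l d x = hom_poly3 l (\<lambda>p q. c p q + d p q) x"
  by (simp add: hom_poly3_def sum.distrib algebra_simps)

lemma hom_poly3_cmult: "b * hom_poly3 l c x = hom_poly3 l (\<lambda>p q. b * c p q) x"
  by (simp add: hom_poly3_def sum_distrib_left algebra_simps)

lemma hom_poly3_sum: "(\<Sum>j\<in>J. hom_poly3 l (c j) x) = hom_poly3 l (\<lambda>p q. \<Sum>j\<in>J. c j p q) x"
proof (induction J rule: infinite_finite_induct)
  case (insert j J)
  then show ?case
    using hom_poly3_add[of l "c j" x "\<lambda>p q. \<Sum>j\<in>J. c j p q"] by simp
qed (simp_all add: hom_poly3_def)

lemma Psi_Sym:
  assumes "f = hom_poly3 l c"
  shows "Psi f \<in> Sym (2 * l)"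
proof -
  have m: "(\<lambda>z. (z$1)^2) \<in> Sym 2" "(\<lambda>z. (z$2)^2) \<in> Sym 2" "(\<lambda>z. z$1 * z$2) \<in> Sym 2"
    using Sym_monom[of 2 0] Sym_monom[of 0 2] Sym_monom[of 1 1] by (simp_all add: numeral_2_eq_2)
  have v: "(\<lambda>z. veronese z $ 1) \<in> Sym 2" "(\<lambda>z. veronese z $ 2) \<in> Sym 2" "(\<lambda>z. veronese z $ 3) \<in> Sym 2"
    using Sym_add[OF m(1) Sym_cmult[OF m(2), of "-1"]] Sym_cmult[OF Sym_add[OF m(1,2)], of \<i>]
      Sym_cmult[OF m(3), of 2]
    by (simp_all add: mult.assoc)
  have "(\<lambda>z. c p q * (veronese z $ 1)^p * (veronese z $ 2)^q * (veronese z $ 3)^(l - p - q)) \<in> Sym (2 * l)"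
    if "p \<le> l" "q \<le> l - p" for p q
  proof -
    have "2 * p + 2 * q + 2 * (l - p - q) = 2 * l"
      using that by simp
    then show ?thesis
      using Sym_mult[OF Sym_mult[OF Sym_cmult[OF Sym_power[OF v(1), of p], of "c p q"]
            Sym_power[OF v(2), of q]] Sym_power[OF v(3), of "l - p - q"]]
      by (simp only:)
  qed
  then show ?thesis
    unfolding assms Psi_def hom_poly3_def comp_def
    by (intro Sym_sum) auto
qed

lemma harmonicC_hom_poly3: "f \<in> harmonicC l \<Longrightarrow> \<exists>c. f = hom_poly3 l c"
  by (auto simp: harmonicC_def)

lemma harmonicR_imp_harmonicC: "f \<in> harmonicR l \<Longrightarrow> f \<in> harmonicC l"
  by (auto simp: harmonicC_def harmonicR_def)

lemma harmonicC_scale: "f \<in> harmonicC l \<Longrightarrow> f (t *s x) = t ^ l * f x"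
  using harmonicC_hom_poly3 hom_poly3_scale by metis

lemma Psi_harmonicC: "f \<in> harmonicC l \<Longrightarrow> Psi f \<in> Sym (2 * l)"
  using harmonicC_hom_poly3 Psi_Sym by blast

lemma conj_poly_harmonicR: "f \<in> harmonicR l \<Longrightarrow> conj_poly f = f"
  by (auto simp: harmonicR_def conj_poly_hom_poly3 Reals_cnj_iff)

text \<open>By \<open>veronese_jmap\<close> the conjugate is evaluated at minus a Veronese vector;
  homogeneity of degree \<open>l\<close> turns the minus into \<open>(-1)^l\<close>, which the sign
  in \<open>sigma_conj\<close> cancels.\<close>

lemma Psi_conj_poly:
  assumes "f \<in> harmonicC l"
  shows "Psi (conj_poly f) = sigma_conj l (Psi f)"
  unfolding fun_eq_iff Psi_def conj_poly_def sigma_conj_def comp_def veronese_jmap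
    harmonicC_scale[OF assms]
  by (simp flip: mult.assoc power_mult_distrib)

text \<open>The trinomial expansion, obtained by applying the binomial theorem twice.\<close>

lemma cdot_power_hom_poly3: "\<exists>c. \<forall>x. cdot u x ^ l = hom_poly3 l c x"
proof (intro exI allI)
  fix x
  have "cdot u x ^ l = (u$1 * x$1 + (u$2 * x$2 + u$3 * x$3)) ^ l"
    by (simp add: cdot_def sum_3 add.assoc)
  also have "\<dots> = hom_poly3 l (\<lambda>p q. of_nat (l choose p) * of_nat (l - p choose q) *
      (u$1)^p * (u$2)^q * (u$3)^(l - p - q)) x"
    unfolding binomial_ring hom_poly3_def
    by (simp add: sum_distrib_left power_mult_distrib mult_ac)
  finally show "cdot u x ^ l = hom_poly3 l (\<lambda>p q. of_nat (l choose p) * of_nat (l - p choose q) *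
      (u$1)^p * (u$2)^q * (u$3)^(l - p - q)) x" .
qed

text \<open>Sums of powers of linear forms are stable under differentiation, so the rule can be
  applied twice. For \<open>l = 0\<close> the truncated exponent is harmless because of the factor
  \<open>of_nat l\<close>.\<close>

lemma partial_deriv_sum_cdot_power:
  "partial_deriv i (\<lambda>x. \<Sum>j\<in>J. c j * cdot (u j) x ^ l) =
     (\<lambda>x. \<Sum>j\<in>J. (of_nat l * c j * u j $ i) * cdot (u j) x ^ (l - 1))"
proof
  fix x
  have cd: "cdot v (x + t *s axis i 1) = cdot v x + t * v $ i" for v t
    by (simp add: cdot_def sum_3 axis_def algebra_simps) (use exhaust_3[of i] in auto)
  have "((\<lambda>t. \<Sum>j\<in>J. c j * cdot (u j) (x + t *s axis i 1) ^ l) has_field_derivative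
     (\<Sum>j\<in>J. (of_nat l * c j * u j $ i) * cdot (u j) x ^ (l - 1))) (at 0)"
    unfolding cd by (auto intro!: derivative_eq_intros sum.cong)
  then show "partial_deriv i (\<lambda>x. \<Sum>j\<in>J. c j * cdot (u j) x ^ l) x =
     (\<Sum>j\<in>J. (of_nat l * c j * u j $ i) * cdot (u j) x ^ (l - 1))"
    unfolding partial_deriv_def by (rule DERIV_imp_deriv)
qed

text \<open>Differentiating twice and summing over the coordinates produces the factor
  \<open>cdot (u j) (u j)\<close> in each summand.\<close>

lemma laplacian_isotropic_powers:
  assumes "\<And>j. j \<in> J \<Longrightarrow> cdot (u j) (u j) = 0"
  shows "laplacian (\<lambda>x. \<Sum>j\<in>J. c j * cdot (u j) x ^ l) x = 0"
proof -
  have "laplacian (\<lambda>x. \<Sum>j\<in>J. c j * cdot (u j) x ^ l) x =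
     (\<Sum>j\<in>J. of_nat (l - 1) * of_nat l * c j * cdot (u j) (u j) * cdot (u j) x ^ (l - 1 - 1))"
    unfolding laplacian_def partial_deriv_sum_cdot_power
    by (subst sum.swap) (simp add: cdot_def sum_distrib_left sum_distrib_right mult_ac)
  also have "\<dots> = 0"
    using assms by (intro sum.neutral) simp
  finally show ?thesis .
qed

lemma isotropic_powers_harmonicC:
  assumes "\<And>j. j \<in> J \<Longrightarrow> cdot (u j) (u j) = 0"
  shows "(\<lambda>x. \<Sum>j\<in>J. c j * cdot (u j) x ^ l) \<in> harmonicC l"
proof -
  have "\<forall>j. \<exists>c. \<forall>x. cdot (u j) x ^ l = hom_poly3 l c x"
    using cdot_power_hom_poly3 by blast
  from choice[OF this] obtain d where "\<And>j x. cdot (u j) x ^ l = hom_poly3 l (d j) x"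
    by blast
  then have "(\<lambda>x. \<Sum>j\<in>J. c j * cdot (u j) x ^ l) = hom_poly3 l (\<lambda>p q. \<Sum>j\<in>J. c j * d j p q)"
    by (simp add: fun_eq_iff hom_poly3_cmult hom_poly3_sum)
  then show ?thesis
    using laplacian_isotropic_powers[of J u c l] assms by (auto simp: harmonicC_def)
qed

text \<open>Averaging a coefficient family with its conjugate leaves a self-conjugate polynomial
  unchanged and makes the coefficients real, with no appeal to uniqueness of coefficients.\<close>

lemma harmonicC_conj_poly_imp_harmonicR:
  assumes f: "f \<in> harmonicC l" and real: "conj_poly f = f"
  shows "f \<in> harmonicR l"
proof -
  obtain c where c: "f = hom_poly3 l c"
    using harmonicC_hom_poly3[OF f] by blast
  have "f x = hom_poly3 l (\<lambda>p q. of_real (Re (c p q))) x" for x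
  proof -
    have "f x = 1/2 * (f x + conj_poly f x)"
      by (simp add: real)
    also have "\<dots> = hom_poly3 l (\<lambda>p q. 1/2 * (c p q + cnj (c p q))) x"
      unfolding c conj_poly_hom_poly3 hom_poly3_add hom_poly3_cmult ..
    also have "(\<lambda>p q. 1/2 * (c p q + cnj (c p q))) = (\<lambda>p q. of_real (Re (c p q)))"
      by (simp add: complex_add_cnj)
    finally show ?thesis .
  qed
  then have "f = hom_poly3 l (\<lambda>p q. of_real (Re (c p q)))"
    by blast
  then show ?thesis
    using f unfolding harmonicR_def harmonicC_def
    by (auto intro!: exI[of _ "\<lambda>p q. of_real (Re (c p q))"])
qed

text \<open>For \<open>w = z\<close> this shows that Veronese vectors are isotropic. In general it
  shows that \<open>Psi\<close> sends powers of isotropic linear forms to even powers of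
  \<open>lin w\<close>.\<close>

lemma cdot_veronese: "cdot (veronese w) (veronese z) = - 2 * lin w z ^ 2"
proof -
  have "cdot (veronese w) (veronese z) = ((w$1)^2 - (w$2)^2) * ((z$1)^2 - (z$2)^2)
      + (\<i> * \<i>) * ((w$1)^2 + (w$2)^2) * ((z$1)^2 + (z$2)^2) + 4 * w$1 * w$2 * z$1 * z$2"
    by (simp add: cdot_def sum_3 algebra_simps del: i_squared)
  then show ?thesis
    by (simp add: lin_def power2_eq_square algebra_simps)
qed

text \<open>Orthogonality of the characters of the cyclic group of order \<open>N\<close>: for
  \<open>m \<noteq> k\<close> the sum is geometric with a ratio \<open>r \<noteq> 1\<close>
  satisfying \<open>r ^ N = 1\<close>.\<close>

lemma sum_roots_of_unity:
  fixes N m k :: nat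
  assumes "m < N" "k < N"
  defines "\<zeta> \<equiv> \<lambda>j. exp (2 * of_real pi * \<i> * of_nat j / of_nat N)"
  shows "(\<Sum>j<N. \<zeta> j ^ m / \<zeta> j ^ k) = (if m = k then of_nat N else 0)"
proof (cases "m = k")
  case False
  define r where "r = \<zeta> m / \<zeta> k"
  have N: "N \<ge> 1"
    using assms by simp
  have "\<zeta> j ^ n = \<zeta> n ^ j" for j n
    by (simp add: \<zeta>_def mult_ac flip: exp_of_nat_mult)
  then have "\<zeta> j ^ m / \<zeta> j ^ k = r ^ j" for j
    by (simp add: r_def power_divide)
  moreover have "(\<Sum>j<N. r ^ j) = (r ^ N - 1) / (r - 1)"
  proof (rule geometric_sum)
    have "\<zeta> m \<noteq> \<zeta> k"
      using complex_root_unity_eq[OF N, of m k] assms(1,2) False by (simp add: \<zeta>_def)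
    then show "r \<noteq> 1"
      by (simp add: r_def \<zeta>_def)
  qed
  moreover have "r ^ N = 1"
    using complex_root_unity[of N] N by (simp add: r_def \<zeta>_def power_divide)
  ultimately show ?thesis
    using False by simp
qed (simp add: \<zeta>_def)

text \<open>The coefficients \<open>c j\<close> are a discrete Fourier transform of those of \<open>F\<close>, which inverts the
  Vandermonde matrix of the nodes \<open>\<zeta> j\<close>.\<close>

lemma Psi_surj_isotropic_powers:
  assumes "F \<in> Sym (2 * l)"
  shows "\<exists>u c. (\<forall>j. cdot (u j) (u j) = 0) \<and>
     Psi (\<lambda>x. \<Sum>j<2 * l + 1. c j * cdot (u j) x ^ l) = F"
proof -
  obtain a where a: "F = binary_form (2 * l) a"
    using assms by (auto simp: Sym_def)
  \<comment> \<open>As many nodes as the dimension of the space of forms of degree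
    \<open>2 * l\<close>, so the exponents occurring are distinct modulo \<open>N\<close>.\<close>
  define N where "N = 2 * l + 1"
  define \<zeta> where "\<zeta> = (\<lambda>j. exp (2 * of_real pi * \<i> * of_nat j / of_nat N))"
  define w where "w = (\<lambda>j. vector [1, \<zeta> j] :: complex^2)"
  define u where "u = (\<lambda>j. veronese (w j))"
  \<comment> \<open>The factor \<open>(-2)^l\<close> compensates the constant of
    \<open>cdot_veronese\<close>, and \<open>(-1)^(2 * l - k)\<close> the sign of the node in
    \<open>lin (w j) z\<close>.\<close>
  define c where "c = (\<lambda>j. \<Sum>k\<le>2 * l. (-1)^(2 * l - k) * a k / (of_nat N * (-2)^l * \<zeta> j ^ (2 * l - k)))"
  have \<zeta>: "\<zeta> j \<noteq> 0" for j
    by (simp add: \<zeta>_def)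
  have iso: "cdot (u j) (u j) = 0" for j
    by (simp add: u_def cdot_veronese)
  have coeff: "(\<Sum>j<N. c j * (-2)^l * (- \<zeta> j) ^ (2 * l - k)) = a k" if k: "k \<le> 2 * l" for k
  proof -
    have "(\<Sum>j<N. c j * (-2)^l * (- \<zeta> j) ^ (2 * l - k)) =
      (\<Sum>j<N. \<Sum>m\<le>2 * l. (-1)^(2 * l - m) * (-1)^(2 * l - k) * a m / of_nat N * (\<zeta> j ^ (2 * l - k) / \<zeta> j ^ (2 * l - m)))"
      unfolding c_def sum_distrib_right
      by (intro sum.cong) (auto simp: power_minus[of "\<zeta> _"])
    also have "\<dots> = (\<Sum>m\<le>2 * l. (-1)^(2 * l - m) * (-1)^(2 * l - k) * a m / of_nat N * (\<Sum>j<N. \<zeta> j ^ (2 * l - k) / \<zeta> j ^ (2 * l - m)))"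
      by (subst sum.swap) (simp add: sum_distrib_left)
    also have "\<dots> = (\<Sum>m\<le>2 * l. if m = k then a m else 0)"
    proof (intro sum.cong refl)
      fix m assume m: "m \<in> {..2 * l}"
      have "(\<Sum>j<N. \<zeta> j ^ (2 * l - k) / \<zeta> j ^ (2 * l - m)) = (if 2 * l - k = 2 * l - m then of_nat N else 0)"
        unfolding \<zeta>_def by (rule sum_roots_of_unity) (auto simp: N_def)
      moreover have "2 * l - k = 2 * l - m \<longleftrightarrow> m = k"
        using k m by auto
      ultimately show "(-1)^(2 * l - m) * (-1)^(2 * l - k) * a m / of_nat N * (\<Sum>j<N. \<zeta> j ^ (2 * l - k) / \<zeta> j ^ (2 * l - m)) = (if m = k then a m else 0)"
        by (simp add: N_def del: of_nat_add of_nat_Suc flip: power_mult_distrib)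
    qed
    also have "\<dots> = a k"
      using k by simp
    finally show ?thesis .
  qed
  have "Psi (\<lambda>x. \<Sum>j<N. c j * cdot (u j) x ^ l) z = F z" for z
  proof -
    have "cdot (u j) (veronese z) ^ l = (-2)^l * (\<Sum>k\<le>2 * l. of_nat (2 * l choose k) * (z$2)^k * (- \<zeta> j)^(2 * l - k) * (z$1)^(2 * l - k))" for j
    proof -
      have "lin (w j) z = z$2 + (- \<zeta> j) * z$1"
        by (simp add: lin_def w_def)
      then have "cdot (u j) (veronese z) ^ l = (-2)^l * (z$2 + (- \<zeta> j) * z$1) ^ (2 * l)"
        by (simp only: u_def cdot_veronese power_mult_distrib power_mult)
      then show ?thesis
        unfolding binomial_ring power_mult_distrib by (simp add: mult_ac)
    qed
    then have "Psi (\<lambda>x. \<Sum>j<N. c j * cdot (u j) x ^ l) z =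
       (\<Sum>j<N. \<Sum>k\<le>2 * l. of_nat (2 * l choose k) * (c j * (-2)^l * (- \<zeta> j)^(2 * l - k)) * (z$1)^(2 * l - k) * (z$2)^k)"
      by (simp add: Psi_def sum_distrib_left mult_ac)
    also have "\<dots> = (\<Sum>k\<le>2 * l. of_nat (2 * l choose k) * (\<Sum>j<N. c j * (-2)^l * (- \<zeta> j)^(2 * l - k)) * (z$1)^(2 * l - k) * (z$2)^k)"
      by (subst sum.swap) (simp only: sum_distrib_left sum_distrib_right)
    also have "\<dots> = F z"
      unfolding a binary_form_def by (intro sum.cong refl) (simp only: coeff atMost_iff)
    finally show ?thesis .
  qed
  then have "Psi (\<lambda>x. \<Sum>j<2 * l + 1. c j * cdot (u j) x ^ l) = F"
    unfolding N_def by blast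
  then show ?thesis
    using iso by blast
qed

lemma Psi_harmonicR: "Psi ` harmonicR l = Fix (Sym (2 * l)) (sigma_conj l)"
proof (intro equalityI subsetI)
  fix F assume "F \<in> Psi ` harmonicR l"
  then show "F \<in> Fix (Sym (2 * l)) (sigma_conj l)"
    using Psi_harmonicC Psi_conj_poly conj_poly_harmonicR harmonicR_imp_harmonicC
    unfolding Fix_def by fastforce
next
  fix F assume "F \<in> Fix (Sym (2 * l)) (sigma_conj l)"
  then have F: "F \<in> Sym (2 * l)" "sigma_conj l F = F"
    by (auto simp: Fix_def)
  obtain u c where u: "\<And>j. cdot (u j) (u j) = 0"
    and Psi_c: "Psi (\<lambda>x. \<Sum>j<2 * l + 1. c j * cdot (u j) x ^ l) = F"
    using Psi_surj_isotropic_powers[OF F(1)] by blast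
  define f where "f = (\<lambda>x. \<Sum>j<2 * l + 1. c j * cdot (u j) x ^ l)"
  \<comment> \<open>The isotropic vectors and their conjugates are indexed disjointly, each with
    half weight. The average \<open>h\<close> of \<open>f\<close> and its conjugate is thus again a
    sum of isotropic powers, hence harmonic.\<close>
  define J where "J = {..<2 * l + 1} <+> {..<2 * l + 1}"
  define h where "h = (\<lambda>x. \<Sum>j\<in>J. case_sum (\<lambda>j. c j / 2) (\<lambda>j. cnj (c j) / 2) j *
     cdot (case_sum u (\<lambda>j. cnj_vec (u j)) j) x ^ l)"
  have conj_f: "conj_poly f = (\<lambda>x. \<Sum>j<2 * l + 1. cnj (c j) * cdot (cnj_vec (u j)) x ^ l)"
    by (simp add: f_def fun_eq_iff conj_poly_def cdot_def)
  have h: "h = (\<lambda>x. (f x + conj_poly f x) / 2)"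
    unfolding conj_f unfolding h_def f_def J_def
    by (subst sum.Plus) (simp_all add: add_divide_distrib sum_divide_distrib del: sum.lessThan_Suc)
  have "cdot (cnj_vec (u j)) (cnj_vec (u j)) = cnj (cdot (u j) (u j))" for j
    by (simp add: cdot_def)
  then have "h \<in> harmonicC l"
    unfolding h_def using u by (intro isotropic_powers_harmonicC) (auto split: sum.splits)
  moreover have "conj_poly h = h"
    unfolding h by (simp add: fun_eq_iff conj_poly_def cnj_vec_def add.commute)
  ultimately have "h \<in> harmonicR l"
    by (rule harmonicC_conj_poly_imp_harmonicR)
  moreover have "f \<in> harmonicC l"
    unfolding f_def using u by (intro isotropic_powers_harmonicC)
  then have "Psi (conj_poly f) = F"
    using Psi_conj_poly F(2) Psi_c f_def by metis
  then have "Psi h = F"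
    using Psi_c unfolding h f_def[symmetric] by (auto simp: Psi_def fun_eq_iff)
  ultimately show "F \<in> Psi ` harmonicR l"
    by blast
qed

section \<open>Root divisors\<close>

text \<open>One representative \<open>w\<close> of the point is fixed here, whereas
  \<open>root_divisor\<close> quantifies over all representatives; \<open>root_divisor_cline\<close>
  shows that the choice does not matter.\<close>

definition mult_ge :: "nat \<Rightarrow> (complex^2 \<Rightarrow> complex) \<Rightarrow> complex^2 \<Rightarrow> nat \<Rightarrow> bool" where
  "mult_ge n F w k \<longleftrightarrow> k \<le> n \<and> (\<exists>G\<in>Sym (n - k). \<forall>z. F z = lin w z ^ k * G z)"

lemma mem_cline [simp]: "w \<in> cline w"
  unfolding cline_def by (rule range_eqI[of _ _ 1]) simp

lemma scale_mem_cline: "x \<in> cline w \<Longrightarrow> c *s x \<in> cline w"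
  by (auto simp: cline_def vector_smult_assoc)

lemma cline_subset: "x \<in> cline w \<Longrightarrow> cline x \<subseteq> cline w"
  by (auto simp: cline_def vector_smult_assoc)

lemma cline_eqI:
  assumes "x \<in> cline w" "x \<noteq> 0"
  shows "cline x = cline w"
proof -
  obtain c where c: "x = c *s w"
    using assms by (auto simp: cline_def)
  with assms(2) have "c \<noteq> 0"
    by auto
  then have "w = inverse c *s x"
    by (simp add: c vector_smult_assoc)
  then have "w \<in> cline x"
    unfolding cline_def by (rule range_eqI)
  then show ?thesis
    using assms(1) cline_subset by blast
qed

lemma mult_ge_scale:
  assumes "c \<noteq> 0" "mult_ge n F (c *s w) k"
  shows "mult_ge n F w k"
proof -
  obtain G where G: "G \<in> Sym (n - k)" "\<And>z. F z = lin (c *s w) z ^ k * G z"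
    using assms by (auto simp: mult_ge_def)
  then show ?thesis
    using assms(2) unfolding mult_ge_def
    by (intro conjI bexI[OF _ Sym_cmult[OF G(1), of "c ^ k"]])
      (auto simp: lin_scale power_mult_distrib)
qed

lemma root_divisor_cline:
  assumes w: "w \<noteq> 0"
  shows "root_divisor n F (cline w) = (GREATEST k. mult_ge n F w k)"
proof -
  have "(k \<le> n \<and> (\<exists>x\<in>cline w. x \<noteq> 0 \<and> (\<exists>G\<in>Sym (n - k). \<forall>z. F z = (x$1 * z$2 - x$2 * z$1)^k * G z)))
      \<longleftrightarrow> mult_ge n F w k" (is "?L k \<longleftrightarrow> _") for k
  proof
    assume "?L k"
    then obtain x where x: "x \<in> cline w" "x \<noteq> 0" "mult_ge n F x k"
      by (auto simp: mult_ge_def lin_def)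
    then obtain c where "x = c *s w" "c \<noteq> 0"
      by (auto simp: cline_def)
    with x(3) show "mult_ge n F w k"
      using mult_ge_scale by blast
  next
    assume "mult_ge n F w k"
    with w show "?L k"
      unfolding mult_ge_def lin_def by (intro conjI bexI[of _ w]) auto
  qed
  then show ?thesis
    unfolding root_divisor_def by simp
qed

lemma mult_ge_0: "F \<in> Sym n \<Longrightarrow> mult_ge n F w 0"
  by (auto simp: mult_ge_def)

lemma mult_ge_le: "mult_ge n F w k \<Longrightarrow> k \<le> n"
  by (simp add: mult_ge_def)

text \<open>\<open>GREATEST\<close> is a genuine maximum: exponent 0 is always admissible and
  \<open>n\<close> is an upper bound.\<close>

lemma mult_ge_Greatest:
  assumes "F \<in> Sym n"
  shows "mult_ge n F w (GREATEST k. mult_ge n F w k)"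
  by (rule GreatestI_nat[of "mult_ge n F w" 0 n]) (simp_all add: mult_ge_0 assms mult_ge_le)

lemma Sym_mult_lin: "F \<in> Sym n \<Longrightarrow> (\<lambda>z. lin w z * F z) \<in> Sym (Suc n)"
  using Sym_mult[OF lin_Sym, of F n w] by simp

lemma Sym_factor_nonzero:
  assumes "w \<noteq> 0" "F \<in> Sym n" "F \<noteq> (\<lambda>z. 0)" "F w = 0"
  obtains m G where "n = Suc m" "G \<in> Sym m" "G \<noteq> (\<lambda>z. 0)" "F = (\<lambda>z. lin w z * G z)"
proof (cases n)
  case 0
  then show thesis
    using Sym_0_root assms by blast
next
  case (Suc m)
  then obtain G where G: "G \<in> Sym m" "\<And>z. F z = lin w z * G z"
    using Sym_factor assms by metis
  then have "F = (\<lambda>z. lin w z * G z)"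
    by blast
  moreover from this have "G \<noteq> (\<lambda>z. 0)"
    using assms(3) by auto
  ultimately show thesis
    using that Suc G(1) by blast
qed

lemma mult_ge_lin_same:
  assumes w: "w \<noteq> 0" and G: "G \<in> Sym n"
  shows "mult_ge (Suc n) (\<lambda>z. lin w z * G z) w (Suc k) \<longleftrightarrow> mult_ge n G w k"
proof
  assume "mult_ge (Suc n) (\<lambda>z. lin w z * G z) w (Suc k)"
  then obtain H where k: "k \<le> n" and H: "H \<in> Sym (n - k)"
    and eq: "\<And>z. lin w z * G z = lin w z * (lin w z ^ k * H z)"
    by (auto simp: mult_ge_def mult.assoc)
  have "G = (\<lambda>z. lin w z ^ k * H z)"
    by (rule lin_mult_cancel[OF w G Sym_mult[OF Sym_power[OF lin_Sym] H] eq])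
  with k H show "mult_ge n G w k"
    by (auto simp: mult_ge_def)
next
  assume "mult_ge n G w k"
  then show "mult_ge (Suc n) (\<lambda>z. lin w z * G z) w (Suc k)"
    by (auto simp: mult_ge_def mult.assoc)
qed

text \<open>Coprimality of distinct linear forms: since \<open>lin u\<close> does not vanish at
  \<open>w\<close>, \<open>G\<close> does, and one factor \<open>lin w\<close> can be stripped from
  both sides. For the zero form the exponent \<open>Suc n\<close> would be a counterexample.\<close>

lemma mult_ge_lin_other:
  assumes w: "w \<noteq> 0" and u: "lin u w \<noteq> 0"
    and "G \<in> Sym n" "G \<noteq> (\<lambda>z. 0)" "mult_ge (Suc n) (\<lambda>z. lin u z * G z) w k"
  shows "mult_ge n G w k"
  using assms(3-)
proof (induction k arbitrary: n G)
  case 0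
  then show ?case
    by (simp add: mult_ge_0)
next
  case (Suc k)
  obtain H where k: "k \<le> n" and H: "H \<in> Sym (n - k)"
    and eq: "\<And>z. lin u z * G z = lin w z ^ Suc k * H z"
    using Suc.prems(3) by (auto simp: mult_ge_def)
  have "G w = 0"
    using eq[of w] u by simp
  then obtain m G' where m: "n = Suc m" and G': "G' \<in> Sym m" "G' \<noteq> (\<lambda>z. 0)"
    and G: "G = (\<lambda>z. lin w z * G' z)"
    using Sym_factor_nonzero[OF w Suc.prems(1,2)] by blast
  have "(\<lambda>z. lin u z * G' z) = (\<lambda>z. lin w z ^ k * H z)"
    using eq by (intro lin_mult_cancel[OF w Sym_mult_lin[OF G'(1)] Sym_mult[OF Sym_power[OF lin_Sym] H]])
      (simp add: G mult_ac)
  then have "mult_ge (Suc m) (\<lambda>z. lin u z * G' z) w k"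
    using k H m by (auto simp: mult_ge_def)
  then have "mult_ge m G' w k"
    by (rule Suc.IH[OF G'])
  then show ?case
    using mult_ge_lin_same[OF w G'(1)] m G by simp
qed

text \<open>At the point of \<open>u\<close> all admissible exponents shift by one; elsewhere the
  new factor is absorbed into the cofactor, and coprimality gives the converse.\<close>

lemma root_divisor_lin_mult:
  assumes u: "u \<noteq> 0" and G: "G \<in> Sym n" "G \<noteq> (\<lambda>z. 0)" and p: "p \<in> CP1"
  shows "root_divisor (Suc n) (\<lambda>z. lin u z * G z) p = root_divisor n G p + (if u \<in> p then 1 else 0)"
proof (cases "u \<in> p")
  case True
  obtain w where "w \<noteq> 0" "p = cline w"
    using p by (auto simp: CP1_def)
  with True u have p_u: "p = cline u"
    using cline_eqI by blast
  have "(GREATEST k. mult_ge (Suc n) (\<lambda>z. lin u z * G z) u k) = Suc (GREATEST k. mult_ge n G u k)"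
  proof (rule Greatest_equality)
    show "mult_ge (Suc n) (\<lambda>z. lin u z * G z) u (Suc (GREATEST k. mult_ge n G u k))"
      unfolding mult_ge_lin_same[OF u G(1)]
      by (rule mult_ge_Greatest[OF G(1)])
  next
    fix k assume "mult_ge (Suc n) (\<lambda>z. lin u z * G z) u k"
    then show "k \<le> Suc (GREATEST k. mult_ge n G u k)"
      using Greatest_le_nat[of "mult_ge n G u" _ n] mult_ge_le mult_ge_lin_same[OF u G(1)] by (cases k) auto
  qed
  with True u show ?thesis
    by (simp add: p_u root_divisor_cline)
next
  case False
  obtain w where w: "w \<noteq> 0" "p = cline w"
    using p by (auto simp: CP1_def)
  with False have lw: "lin w u \<noteq> 0"
    by (simp add: lin_eq_0_iff)
  have lu: "lin u w \<noteq> 0"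
  proof -
    have "lin u w = - lin w u"
      by (simp add: lin_def)
    with lw show ?thesis by simp
  qed
  have "mult_ge (Suc n) (\<lambda>z. lin u z * G z) w k \<longleftrightarrow> mult_ge n G w k" for k
  proof
    assume k: "mult_ge n G w k"
    then obtain H where H: "H \<in> Sym (n - k)" "\<And>z. G z = lin w z ^ k * H z"
      by (auto simp: mult_ge_def)
    then have "\<forall>z. lin u z * G z = lin w z ^ k * (lin u z * H z)"
      by (simp add: mult_ac)
    moreover have "(\<lambda>z. lin u z * H z) \<in> Sym (Suc n - k)"
      using Sym_mult_lin[OF H(1)] mult_ge_le[OF k] by (simp add: Suc_diff_le)
    ultimately show "mult_ge (Suc n) (\<lambda>z. lin u z * G z) w k"
      using mult_ge_le[OF k] unfolding mult_ge_def by (meson le_SucI)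
  qed (rule mult_ge_lin_other[OF w(1) lu G])
  with False w show ?thesis
    by (simp add: root_divisor_cline)
qed

section \<open>The antipodal map and symmetric root divisors\<close>

lemma jmap_cline: "jmap ` cline w = cline (jmap w)"
proof -
  have "jmap ` cline w = range (\<lambda>c. cnj c *s jmap w)"
    by (simp add: cline_def image_image jmap_scale)
  also have "\<dots> = cline (jmap w)"
    unfolding cline_def by (auto intro: range_eqI[of _ _ "cnj _"])
  finally show ?thesis .
qed

lemma antipode_cline: "antipode (cline w) = cline (jmap w)"
  by (simp add: antipode_def jmap_cline)

lemma antipode_CP1: "p \<in> CP1 \<Longrightarrow> antipode p \<in> CP1"
  by (auto simp: CP1_def antipode_cline)

lemma mem_antipode_iff:
  assumes "p \<in> CP1"
  shows "w \<in> antipode p \<longleftrightarrow> jmap w \<in> p"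
proof -
  obtain x where p: "p = cline x"
    using assms by (auto simp: CP1_def)
  show ?thesis
  proof
    assume "w \<in> antipode p"
    then obtain y where "y \<in> p" "w = jmap y"
      by (auto simp: antipode_def)
    then show "jmap w \<in> p"
      using scale_mem_cline p jmap_jmap by metis
  next
    assume "jmap w \<in> p"
    then have "(-1) *s jmap w \<in> p"
      using scale_mem_cline p by blast
    moreover have "w = jmap ((-1) *s jmap w)"
      by (simp add: vec_eq_iff forall_2)
    ultimately show "w \<in> antipode p"
      unfolding antipode_def by blast
  qed
qed

lemma jmap_mem_antipode_iff:
  assumes "p \<in> CP1"
  shows "jmap w \<in> antipode p \<longleftrightarrow> w \<in> p"
proof -
  obtain x where p: "p = cline x"
    using assms by (auto simp: CP1_def)
  have "w = (-1) *s ((-1) *s w)"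
    by (simp add: vector_smult_assoc)
  then have "(-1) *s w \<in> p \<longleftrightarrow> w \<in> p"
    using scale_mem_cline p by metis
  then show ?thesis
    using mem_antipode_iff[OF assms, of "jmap w"] by (simp add: jmap_jmap)
qed

lemma lin_jmap: "cnj (lin w (jmap z)) = - lin (jmap w) z"
  by (simp add: lin_def)

text \<open>The value is minus the squared norm of \<open>w\<close>; geometrically, no point of the
  projective line is its own antipode.\<close>

lemma lin_jmap_self:
  assumes "w \<noteq> 0"
  shows "lin (jmap w) w \<noteq> 0"
proof -
  have "lin (jmap w) w = - of_real ((cmod (w$1))\<^sup>2 + (cmod (w$2))\<^sup>2)"
    unfolding of_real_add complex_norm_square by (simp add: lin_def mult.commute)
  moreover have "(cmod (w$1))\<^sup>2 + (cmod (w$2))\<^sup>2 \<noteq> 0"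
    using assms by (auto simp: vec_eq_iff forall_2 sum_power2_eq_zero_iff)
  ultimately show ?thesis
    by (metis neg_equal_0_iff_equal of_real_eq_0_iff)
qed

text \<open>Conjugating a factorisation after pulling it back along \<open>jmap\<close> exchanges
  \<open>lin w\<close> and \<open>lin (jmap w)\<close> up to sign. The constant
  \<open>\<kappa>\<close> allows for multiples of fixed forms.\<close>

lemma mult_ge_jmap:
  assumes F: "\<And>z. F z = \<kappa> * cnj (F (jmap z))" and k: "mult_ge n F w k"
  shows "mult_ge n F (jmap w) k"
proof -
  obtain G where G: "G \<in> Sym (n - k)" "\<And>z. F z = lin w z ^ k * G z"
    using k by (auto simp: mult_ge_def)
  have "F z = lin (jmap w) z ^ k * ((-1) ^ k * \<kappa> * cnj (G (jmap z)))" for z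
  proof -
    have "F z = \<kappa> * ((- lin (jmap w) z) ^ k * cnj (G (jmap z)))"
      using F[of z] unfolding G(2)[of "jmap z"] complex_cnj_mult complex_cnj_power lin_jmap .
    then show ?thesis
      by (simp add: power_minus[of "lin (jmap w) z"] mult_ac)
  qed
  moreover have "(\<lambda>z. (-1) ^ k * \<kappa> * cnj (G (jmap z))) \<in> Sym (n - k)"
    by (intro Sym_cmult Sym_jmap G)
  ultimately show ?thesis
    using k unfolding mult_ge_def by auto
qed

lemma multiple_of_fixed_antipodal:
  assumes F: "F \<noteq> (\<lambda>z. 0)" and G: "G \<in> Fix (Sym (2 * l)) (sigma_conj l)" "F = (\<lambda>z. c * G z)"
  shows "antipodal_invariant (root_divisor (2 * l) F)"
  unfolding antipodal_invariant_def
proof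
  fix p assume "p \<in> CP1"
  then obtain w where w: "w \<noteq> 0" "p = cline w"
    by (auto simp: CP1_def)
  have c: "c \<noteq> 0"
    using F G(2) by auto
  have "G z = (-1) ^ l * cnj (G (jmap z))" for z
    using G(1) unfolding Fix_def by (auto simp: sigma_conj_def fun_eq_iff)
  then have "F z = c * ((-1) ^ l * cnj (G (jmap z)))" for z
    unfolding G(2) by (rule arg_cong)
  moreover have "cnj (F (jmap z)) = cnj c * cnj (G (jmap z))" for z
    by (simp add: G(2))
  \<comment> \<open>A multiple of a fixed form satisfies the fixed point equation up to the phase
    \<open>c / cnj c\<close>.\<close>
  ultimately have FF: "F z = (c / cnj c * (-1) ^ l) * cnj (F (jmap z))" for z
    using c by simp
  have jmap: "mult_ge (2 * l) F x k \<Longrightarrow> mult_ge (2 * l) F (jmap x) k" for x k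
    using mult_ge_jmap[of F "c / cnj c * (-1) ^ l"] FF by blast
  have "mult_ge (2 * l) F (jmap w) k \<longleftrightarrow> mult_ge (2 * l) F w k" for k
  proof
    assume "mult_ge (2 * l) F (jmap w) k"
    then have "mult_ge (2 * l) F (jmap (jmap w)) k"
      by (rule jmap)
    then show "mult_ge (2 * l) F w k"
      using mult_ge_scale[of "-1"] unfolding jmap_jmap by simp
  qed (rule jmap)
  then show "root_divisor (2 * l) F (antipode p) = root_divisor (2 * l) F p"
    using w by (simp add: antipode_cline root_divisor_cline)
qed

section \<open>Quadratic forms of real vectors and the factorisation into them\<close>

lemma Qform_eq: "Qform x z = (x$1 + \<i> * x$2) * (z$1)^2 + 2 * x$3 * z$1 * z$2 + (- x$1 + \<i> * x$2) * (z$2)^2"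
  by (simp add: Qform_def cdot_def sum_3 algebra_simps)

lemma complexify_component [simp]: "complexify a $ i = complex_of_real (a $ i)"
  by (simp add: complexify_def)

lemma Qform_Sym: "Qform x \<in> Sym 2"
proof -
  have "Qform x = hom_poly3 1 (\<lambda>p q. if p = 1 then x$1 else if q = 1 then x$2 else x$3) \<circ> veronese"
    by (simp add: fun_eq_iff hom_poly3_def Qform_def cdot_def sum_3)
  then show ?thesis
    using Psi_Sym[of _ 1] by (simp add: Psi_def)
qed

text \<open>This says that \<open>Qform (complexify a)\<close> is fixed by
  \<open>sigma_conj 1\<close>.\<close>

lemma Qform_jmap: "cnj (Qform (complexify a) (jmap z)) = - Qform (complexify a) z"
  by (simp add: Qform_eq algebra_simps)

lemma Qform_inject:
  assumes "\<And>z. Qform (complexify a) z = Qform (complexify b) z"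
  shows "a = b"
proof -
  have 12: "a$1 = b$1" "a$2 = b$2"
    using assms[of "vector [1, 0]"] by (auto simp: Qform_eq complex_eq_iff)
  moreover have "a$3 = b$3"
    using assms[of "vector [1, 1]"] by (auto simp: Qform_eq complex_eq_iff 12)
  ultimately show ?thesis
    by (simp add: vec_eq_iff forall_3)
qed

lemma Qform_nonzero:
  assumes "a \<noteq> 0"
  shows "Qform (complexify a) \<noteq> (\<lambda>z. 0)"
proof
  assume "Qform (complexify a) = (\<lambda>z. 0)"
  then have "Qform (complexify a) z = Qform (complexify 0) z" for z
    by (simp add: Qform_eq)
  then show False
    using Qform_inject assms by blast
qed

lemma Qform_scale: "Qform (complexify (r *\<^sub>R a)) z = of_real r * Qform (complexify a) z"
  by (simp add: Qform_eq algebra_simps)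

text \<open>By \<open>Qform_jmap\<close> the antipode of a root is again a root, and it is a
  different point; two linear factors exhaust the degree.\<close>

lemma Qform_antipodal_roots:
  assumes "a \<noteq> 0" "w \<noteq> 0" "Qform (complexify a) w = 0"
  obtains c where "c \<noteq> 0" "\<And>z. Qform (complexify a) z = lin w z * (lin (jmap w) z * c)"
proof -
  have Q2: "Qform (complexify a) \<in> Sym (Suc (Suc 0))"
    using Qform_Sym[of "complexify a"] by (simp only: numeral_2_eq_2)
  obtain G where G: "G \<in> Sym (Suc 0)" "\<And>z. Qform (complexify a) z = lin w z * G z"
    using Sym_factor[OF assms(2) Q2 assms(3)] by blast
  have "Qform (complexify a) (jmap w) = 0"
    using Qform_jmap[of a w] assms(3) by simp
  moreover have "lin w (jmap w) \<noteq> 0"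
    using lin_jmap_self[OF assms(2)] lin_jmap[of w w] by auto
  ultimately have "G (jmap w) = 0"
    using G(2) by simp
  then obtain H where H: "H \<in> Sym 0" "\<And>z. G z = lin (jmap w) z * H z"
    using Sym_factor[of "jmap w" G 0] G(1) assms(2) by auto
  then obtain c where c: "\<And>z. H z = c"
    by (auto simp: Sym_iff)
  have "Qform (complexify a) z = lin w z * (lin (jmap w) z * c)" for z
    by (simp add: G(2) H(2) c)
  moreover from this have "c \<noteq> 0"
    using Qform_nonzero[OF assms(1)] by auto
  ultimately show thesis
    using that by blast
qed

text \<open>Both forms have the same antipodal pair of roots, so they differ by a constant factor.
  That factor is real because both satisfy \<open>Qform_jmap\<close>.\<close>

lemma Qform_common_root:
  assumes "a \<noteq> 0" "b \<noteq> 0" "w \<noteq> 0" "Qform (complexify a) w = 0" "Qform (complexify b) w = 0"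
  obtains r where "r \<noteq> 0" "a = r *\<^sub>R b"
proof -
  obtain c where c: "c \<noteq> 0" "\<And>z. Qform (complexify a) z = lin w z * (lin (jmap w) z * c)"
    using Qform_antipodal_roots assms by metis
  obtain d where d: "d \<noteq> 0" "\<And>z. Qform (complexify b) z = lin w z * (lin (jmap w) z * d)"
    using Qform_antipodal_roots assms by metis
  define r where "r = c / d"
  have r: "Qform (complexify a) z = r * Qform (complexify b) z" for z
    using c(2)[of z] d by (simp add: r_def)
  obtain z where z: "Qform (complexify b) z \<noteq> 0"
    using Qform_nonzero[OF assms(2)] by blast
  have "- Qform (complexify a) z = cnj r * (- Qform (complexify b) z)"
    using r[of "jmap z"] Qform_jmap[of a z] Qform_jmap[of b z] by (metis complex_cnj_mult)
  then have "cnj r = r"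
    using r[of z] z by simp
  then obtain s where s: "r = of_real s"
    by (metis Reals_cnj_iff Reals_cases)
  have "a = s *\<^sub>R b"
    by (rule Qform_inject) (simp add: r s Qform_scale)
  moreover from this have "s \<noteq> 0"
    using assms(1) by auto
  ultimately show thesis
    using that by blast
qed

lemma Qform_mult_cancel:
  assumes a: "a \<noteq> 0" and F: "F \<in> Sym m" and G: "G \<in> Sym n"
    and eq: "\<And>z. Qform (complexify a) z * F z = Qform (complexify a) z * G z"
  shows "F = G"
proof -
  obtain w where w: "w \<noteq> 0" "Qform (complexify a) w = 0"
    using Sym_has_root[of "Qform (complexify a)" 1] Qform_Sym[of "complexify a"]
    by (auto simp: numeral_2_eq_2)
  obtain c where c: "c \<noteq> 0" "\<And>z. Qform (complexify a) z = lin w z * (lin (jmap w) z * c)"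
    using Qform_antipodal_roots a w by metis
  have "lin w z * (lin (jmap w) z * F z) = lin w z * (lin (jmap w) z * G z)" for z
    using eq[of z] c by auto
  then have "(\<lambda>z. lin (jmap w) z * F z) = (\<lambda>z. lin (jmap w) z * G z)"
    by (rule lin_mult_cancel[OF w(1) Sym_mult_lin[OF F] Sym_mult_lin[OF G]])
  then show ?thesis
    using lin_mult_cancel[of "jmap w" F m G n] F G w(1) by (meson jmap_eq_0_iff)
qed

lemma antipodal_pair_Qform:
  assumes "w \<noteq> 0"
  obtains a where "a \<noteq> 0" "\<And>z. lin w z * lin (jmap w) z = Qform (complexify a) z"
proof -
  define p where "p = w$2 * cnj (w$1)"
  \<comment> \<open>Read off from the coefficients of the product of the two linear forms. It is the
    point of the sphere belonging to the line of \<open>w\<close>, times minus half the squared norm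
    of \<open>w\<close>.\<close>
  define a :: "real^3" where "a = vector [Re p, Im p, ((cmod (w$2))\<^sup>2 - (cmod (w$1))\<^sup>2) / 2]"
  have p: "of_real (Re p) + \<i> * of_real (Im p) = p" "- of_real (Re p) + \<i> * of_real (Im p) = - cnj p"
    by (simp_all add: complex_eq_iff)
  have "2 * complex_of_real (a$3) = w$2 * cnj (w$2) - w$1 * cnj (w$1)"
    by (simp add: a_def of_real_diff flip: complex_norm_square)
  moreover have "a$1 = Re p" "a$2 = Im p"
    by (simp_all add: a_def)
  ultimately have Q: "Qform (complexify a) z = p * (z$1)^2 + (w$2 * cnj (w$2) - w$1 * cnj (w$1)) * z$1 * z$2 - cnj p * (z$2)^2" for z
    unfolding Qform_eq complexify_component by (simp only: p) simp
  then have eq: "lin w z * lin (jmap w) z = Qform (complexify a) z" for z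
    unfolding Q by (simp add: lin_def p_def power2_eq_square algebra_simps)
  moreover have "a \<noteq> 0"
  proof
    assume "a = 0"
    then have zero: "lin w z * (lin (jmap w) z * 1) = lin w z * 0" for z
      using eq[of z] by (simp add: Qform_eq)
    have "(\<lambda>z. lin (jmap w) z * 1) = (\<lambda>z. 0)"
      by (rule lin_mult_cancel[OF assms Sym_mult_lin[OF Sym_const] Sym_zero zero])
    then show False
      using ex_lin_nonzero[of "jmap w"] assms by (auto simp: fun_eq_iff)
  qed
  ultimately show thesis
    using that by blast
qed

text \<open>Induction on \<open>l\<close>: a root \<open>w\<close> and its antipode are removed
  together, and their product is a real quadratic form by
  \<open>antipodal_pair_Qform\<close>.\<close>

lemma antipodal_factorization:
  assumes "F \<in> Sym (2 * l)" "F \<noteq> (\<lambda>z. 0)" "antipodal_invariant (root_divisor (2 * l) F)"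
  shows "\<exists>lam as. lam \<noteq> 0 \<and> length as = l \<and> 0 \<notin> set as \<and>
    F = (\<lambda>z. lam * (\<Prod>a\<leftarrow>as. Qform (complexify a) z))"
  using assms
proof (induction l arbitrary: F)
  case 0
  then obtain c where "F = (\<lambda>z. c)"
    by (auto simp: Sym_iff)
  then show ?case
    using 0 by (intro exI[of _ c] exI[of _ "[]"]) auto
next
  case (Suc l)
  define n where "n = 2 * l"
  have F: "F \<in> Sym (Suc (Suc n))"
    using Suc.prems(1) by (simp add: n_def)
  have inv: "root_divisor (Suc (Suc n)) F (antipode p) = root_divisor (Suc (Suc n)) F p" if "p \<in> CP1" for p
    using Suc.prems(3) that by (simp add: antipodal_invariant_def n_def)
  obtain w where w: "w \<noteq> 0" "F w = 0"
    using Sym_has_root[OF F] by blast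
  then obtain G where G: "G \<in> Sym (Suc n)" "G \<noteq> (\<lambda>z. 0)" "F = (\<lambda>z. lin w z * G z)"
    using Sym_factor_nonzero[OF w(1) F Suc.prems(2)] by blast
  have jw: "jmap w \<noteq> 0" "w \<notin> cline (jmap w)"
    using w(1) lin_jmap_self[OF w(1)] lin_eq_0_iff[of "jmap w"] by auto
  have CP: "cline w \<in> CP1" "cline (jmap w) \<in> CP1"
    using w(1) jw(1) by (auto simp: CP1_def)
  \<comment> \<open>The multiplicities of \<open>F\<close> at the two antipodal points agree, but
    the removed factor \<open>lin w\<close> counts only at the first. Hence \<open>G\<close> still
    vanishes at \<open>jmap w\<close>.\<close>
  have "root_divisor (Suc n) G (cline (jmap w)) = root_divisor (Suc n) G (cline w) + 1"
    using inv[OF CP(1)] root_divisor_lin_mult[OF w(1) G(1,2) CP(1)]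
      root_divisor_lin_mult[OF w(1) G(1,2) CP(2)] jw
    by (simp add: G(3) antipode_cline)
  then obtain k where k: "(GREATEST k. mult_ge (Suc n) G (jmap w) k) = Suc k"
    unfolding root_divisor_cline[OF jw(1)] by simp
  have "mult_ge (Suc n) G (jmap w) (GREATEST k. mult_ge (Suc n) G (jmap w) k)"
    by (rule mult_ge_Greatest[OF G(1)])
  then have "G (jmap w) = 0"
    unfolding k by (auto simp: mult_ge_def)
  then obtain H where H: "H \<in> Sym n" "H \<noteq> (\<lambda>z. 0)" "G = (\<lambda>z. lin (jmap w) z * H z)"
    using Sym_factor_nonzero[OF jw(1) G(1,2)] by blast
  have rd: "root_divisor (Suc (Suc n)) F p = root_divisor n H p + (if jmap w \<in> p then 1 else 0) + (if w \<in> p then 1 else 0)"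
    if "p \<in> CP1" for p
    using root_divisor_lin_mult[OF w(1) G(1,2) that] root_divisor_lin_mult[OF jw(1) H(1,2) that]
    unfolding G(3) H(3) by simp
  \<comment> \<open>The two correction terms in \<open>rd\<close> are exchanged by the antipodal
    map, so the symmetry passes to \<open>H\<close>.\<close>
  have "root_divisor n H (antipode p) = root_divisor n H p" if "p \<in> CP1" for p
    using inv[OF that] rd[OF that]
      rd[OF antipode_CP1[OF that], unfolded jmap_mem_antipode_iff[OF that], unfolded mem_antipode_iff[OF that]]
    by simp
  then have "antipodal_invariant (root_divisor n H)"
    by (simp add: antipodal_invariant_def)
  then obtain lam as where as: "lam \<noteq> 0" "length as = l" "0 \<notin> set as"
    "H = (\<lambda>z. lam * (\<Prod>a\<leftarrow>as. Qform (complexify a) z))"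
    using Suc.IH H(1,2) unfolding n_def by blast
  obtain a where a: "a \<noteq> 0" "\<And>z. lin w z * lin (jmap w) z = Qform (complexify a) z"
    using antipodal_pair_Qform[OF w(1)] by blast
  have "F z = Qform (complexify a) z * H z" for z
    unfolding a(2)[symmetric] G(3) H(3) by (rule mult.assoc[symmetric])
  then have "F = (\<lambda>z. lam * (\<Prod>a\<leftarrow>a # as. Qform (complexify a) z))"
    by (simp add: fun_eq_iff as(4) mult_ac)
  with as a show ?case
    by (intro exI[of _ lam] exI[of _ "a # as"]) auto
qed

lemma Sym_prod_Qform: "(\<lambda>z. \<Prod>a\<leftarrow>as. Qform (complexify a) z) \<in> Sym (2 * length as)"
  by (rule Sym_prod_list) (rule Qform_Sym)

lemma span_singleton_scale:
  fixes a :: "'a::real_vector"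
  assumes "r \<noteq> 0"
  shows "span {r *\<^sub>R a} = span {a}"
proof -
  have "a = inverse r *\<^sub>R (r *\<^sub>R a)"
    using assms by simp
  then have "a \<in> span {r *\<^sub>R a}"
    by (metis span_base span_scale singletonI)
  then show ?thesis
    by (intro equalityI span_minimal) (auto intro: span_scale span_base)
qed

text \<open>A root of the first factor on the left is a root of some factor on the right. These two
  factors are proportional over the reals, span the same line, and can be cancelled.\<close>

lemma factorization_unique:
  assumes "0 \<notin> set as" "0 \<notin> set bs" "length as = length bs" "lam \<noteq> 0" "mu \<noteq> 0"
    and "(\<lambda>z. lam * (\<Prod>a\<leftarrow>as. Qform (complexify a) z)) = (\<lambda>z. mu * (\<Prod>a\<leftarrow>bs. Qform (complexify a) z))"
  shows "mset (map (\<lambda>a. span {a}) as) = mset (map (\<lambda>a. span {a}) bs)"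
  using assms
proof (induction as arbitrary: bs lam)
  case (Cons a as)
  have a: "a \<noteq> 0"
    using Cons.prems(1) by auto
  obtain w where w: "w \<noteq> 0" "Qform (complexify a) w = 0"
    using Sym_has_root[of "Qform (complexify a)" 1] Qform_Sym[of "complexify a"]
    by (auto simp: numeral_2_eq_2)
  have "(\<Prod>b\<leftarrow>bs. Qform (complexify b) w) = 0"
    using fun_cong[OF Cons.prems(6), of w] w(2) Cons.prems(5) by simp
  then obtain b where b: "b \<in> set bs" "Qform (complexify b) w = 0"
    by (auto simp: prod_list_zero_iff)
  then have b0: "b \<noteq> 0"
    using Cons.prems(2) by blast
  obtain r where r: "r \<noteq> 0" "a = r *\<^sub>R b"
    using Qform_common_root[OF a b0 w(1,2) b(2)] by blast
  obtain xs ys where bs: "bs = xs @ b # ys"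
    using split_list[OF b(1)] by blast
  \<comment> \<open>The proportionality factor \<open>r\<close> moves into the scalar, which is why
    the induction generalises over \<open>lam\<close>.\<close>
  have "(\<lambda>z. (lam * of_real r) * (\<Prod>a\<leftarrow>as. Qform (complexify a) z)) =
      (\<lambda>z. mu * (\<Prod>a\<leftarrow>xs @ ys. Qform (complexify a) z))"
  proof (rule Qform_mult_cancel[OF b0 Sym_cmult[OF Sym_prod_Qform] Sym_cmult[OF Sym_prod_Qform]])
    fix z
    show "Qform (complexify b) z * (lam * of_real r * (\<Prod>a\<leftarrow>as. Qform (complexify a) z)) =
      Qform (complexify b) z * (mu * (\<Prod>a\<leftarrow>xs @ ys. Qform (complexify a) z))"
      using fun_cong[OF Cons.prems(6), of z] by (simp add: bs r(2) Qform_scale mult_ac)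
  qed
  then have "mset (map (\<lambda>a. span {a}) as) = mset (map (\<lambda>a. span {a}) (xs @ ys))"
    using Cons.prems r(1) by (intro Cons.IH[of _ "lam * of_real r"]) (auto simp: bs)
  then show ?case
    by (simp add: bs r span_singleton_scale)
qed simp

lemma sigma_conj_prod_Qform:
  "sigma_conj (length as) (\<lambda>z. \<Prod>a\<leftarrow>as. Qform (complexify a) z) = (\<lambda>z. \<Prod>a\<leftarrow>as. Qform (complexify a) z)"
proof -
  have "cnj (\<Prod>a\<leftarrow>as. Qform (complexify a) (jmap z)) = (-1) ^ length as * (\<Prod>a\<leftarrow>as. Qform (complexify a) z)" for z
    by (induction as) (simp_all add: Qform_jmap)
  then show ?thesis
    by (simp add: fun_eq_iff sigma_conj_def flip: mult.assoc power_mult_distrib)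
qed

lemma prod_Qform_Fix:
  "(\<lambda>z. \<Prod>a\<leftarrow>as. Qform (complexify a) z) \<in> Fix (Sym (2 * length as)) (sigma_conj (length as))"
  by (simp add: Fix_def Sym_prod_Qform sigma_conj_prod_Qform)

lemma antipodal_iff_multiple_of_fixed:
  assumes "F \<in> Sym (2 * l)" "F \<noteq> (\<lambda>z. 0)"
  shows "(\<exists>c. \<exists>G\<in>Fix (Sym (2 * l)) (sigma_conj l). F = (\<lambda>z. c * G z)) \<longleftrightarrow>
    antipodal_invariant (root_divisor (2 * l) F)"
proof
  assume "antipodal_invariant (root_divisor (2 * l) F)"
  then obtain lam as where "length as = l" "F = (\<lambda>z. lam * (\<Prod>a\<leftarrow>as. Qform (complexify a) z))"
    using antipodal_factorization[OF assms] by blast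
  then show "\<exists>c. \<exists>G\<in>Fix (Sym (2 * l)) (sigma_conj l). F = (\<lambda>z. c * G z)"
    using prod_Qform_Fix[of as] by auto
qed (use multiple_of_fixed_antipodal assms(2) in blast)

text \<open>The product of the real quadratic forms is fixed, so \<open>sigma_conj\<close> only
  conjugates the scalar.\<close>

lemma factor_real_iff_fixed:
  assumes F: "F \<in> Sym (2 * l)" "F \<noteq> (\<lambda>z. 0)"
    and as: "length as = l" "F = (\<lambda>z. lam * (\<Prod>a\<leftarrow>as. Qform (complexify a) z))"
  shows "lam \<in> \<real> \<longleftrightarrow> F \<in> Fix (Sym (2 * l)) (sigma_conj l)"
proof -
  have "sigma_conj l F = (\<lambda>z. cnj lam * (\<Prod>a\<leftarrow>as. Qform (complexify a) z))"
    using sigma_conj_prod_Qform[of as] unfolding as sigma_conj_scale by (simp add: as(1))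
  moreover obtain z where "(\<Prod>a\<leftarrow>as. Qform (complexify a) z) \<noteq> 0"
    using F(2) as(2) by (metis mult_zero_right)
  ultimately have "sigma_conj l F = F \<longleftrightarrow> cnj lam = lam"
    unfolding as(2) fun_eq_iff by (metis mult_cancel_right)
  then show ?thesis
    using F(1) by (simp add: Fix_def Reals_cnj_iff)
qed

section \<open>Invariants and the orthogonal group\<close>

lemma form_space_iff: "F \<in> form_space L \<longleftrightarrow> (\<exists>a. F = forms_of_coeffs L a)"
proof
  assume F: "F \<in> form_space L"
  then have "\<forall>l\<in>{..L}. \<exists>a. F l = binary_form (2 * l) a"
    by (auto simp: form_space_def Sym_def)
  from bchoice[OF this] obtain a where "\<And>l. l \<le> L \<Longrightarrow> F l = binary_form (2 * l) (a l)"
    by auto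
  with F have "F = forms_of_coeffs L a"
    by (auto simp: fun_eq_iff forms_of_coeffs_def form_space_def)
  then show "\<exists>a. F = forms_of_coeffs L a"
    by blast
qed (auto simp: form_space_def forms_of_coeffs_def Sym_def)

lemma Psi_system_form_space:
  "(\<And>l. l \<le> L \<Longrightarrow> f l \<in> harmonicC l) \<Longrightarrow> Psi_system L f \<in> form_space L"
  by (auto simp: form_space_def Psi_system_def Psi_harmonicC)

lemma form_space_scale: "F \<in> form_space L \<Longrightarrow> (\<lambda>l z. t l * F l z) \<in> form_space L"
  by (auto simp: form_space_def Sym_cmult fun_eq_iff)

lemma form_space_form_act:
  assumes "g \<in> SL2" "F \<in> form_space L"
  shows "(\<lambda>l. form_act g (F l)) \<in> form_space L"
  using assms by (auto simp: form_space_def Sym_form_act form_act_def fun_eq_iff)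

lemma invariants_act:
  "\<lbrakk>I \<in> invariants L; g \<in> SL2; F \<in> form_space L\<rbrakk> \<Longrightarrow> I (\<lambda>l. form_act g (F l)) = I F"
  by (auto simp: invariants_def)

text \<open>The specialisation \<open>t l = e ^ l\<close>: a sign that enters each form with
  exponent \<open>l\<close> leaves the invariant with exponent the weight.\<close>

lemma multihomogeneous_sign:
  assumes "multihomogeneous L d I" "F \<in> form_space L"
  shows "I (\<lambda>l z. e ^ l * F l z) = e ^ (\<Sum>l\<le>L. l * d l) * I F"
  using assms unfolding multihomogeneous_def by (simp add: power_sum power_mult)

lemma real_coeffs_cnj:
  assumes I: "real_coeffs L I" and F: "F \<in> form_space L"
  shows "I (\<lambda>l z. cnj (F l (cnj_vec z))) = cnj (I F)"
proof -
  obtain M c where c: "\<And>m. m \<in> M \<Longrightarrow> c m \<in> \<real>"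
    and I: "\<And>a. I (forms_of_coeffs L a) = (\<Sum>m\<in>M. c m * (\<Prod>l\<le>L. \<Prod>k\<le>2 * l. a l k ^ m l k))"
    using I unfolding real_coeffs_def poly_functions_def by blast
  obtain a where a: "F = forms_of_coeffs L a"
    using F form_space_iff by blast
  have "(\<lambda>l z. cnj (F l (cnj_vec z))) = forms_of_coeffs L (\<lambda>l k. cnj (a l k))"
    by (auto simp: a fun_eq_iff forms_of_coeffs_def binary_form_def)
  then show ?thesis
    using c by (simp add: a I Reals_cnj_iff cong: sum.cong)
qed

lemma invariant_real_harmonics:
  assumes I: "I \<in> invariants L" "multihomogeneous L d I" "real_coeffs L I"
    and f: "\<And>l. l \<le> L \<Longrightarrow> f l \<in> harmonicR l"
  shows "I (Psi_system L f) = (-1) ^ (\<Sum>l\<le>L. l * d l) * cnj (I (Psi_system L f))"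
proof -
  define F where "F = Psi_system L f"
  have F: "F \<in> form_space L"
    unfolding F_def using f harmonicR_imp_harmonicC by (intro Psi_system_form_space) blast
  define F' where "F' = (\<lambda>l z. cnj (F l (cnj_vec z)))"
  have F': "F' \<in> form_space L"
    using F by (auto simp: F'_def form_space_def Sym_cnj)
  \<comment> \<open>The inverse of \<open>g\<close> followed by conjugation of the coordinates is
    \<open>jmap\<close>, so acting by \<open>g\<close> on the conjugated system gives
    \<open>sigma_conj\<close> up to \<open>(-1)^l\<close>.\<close>
  define g :: "complex^2^2" where "g = vector [vector [0, 1], vector [-1, 0]]"
  have g: "g \<in> SL2"
    by (simp add: g_def SL2_def det_2)
  have "F l z = (-1) ^ l * form_act g (F' l) z" for l z
  proof -
    have "cnj_vec (vector [g$2$2 * z$1 - g$1$2 * z$2, g$1$1 * z$2 - g$2$1 * z$1]) = jmap z"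
      by (simp add: g_def vec_eq_iff forall_2)
    then have act: "form_act g (F' l) z = cnj (F l (jmap z))"
      by (simp add: form_act_SL2[OF g] F'_def)
    show ?thesis
    proof (cases "l \<le> L")
      case True
      then have "Psi (f l) = sigma_conj l (Psi (f l))"
        using Psi_conj_poly[of "f l" l] conj_poly_harmonicR[OF f] harmonicR_imp_harmonicC[OF f] by simp
      with True have "F l z = sigma_conj l (F l) z"
        by (metis F_def Psi_system_def)
      then show ?thesis
        unfolding act sigma_conj_def .
    qed (simp add: act F_def Psi_system_def)
  qed
  then have "F = (\<lambda>l z. (-1) ^ l * form_act g (F' l) z)"
    by (intro ext)
  then have "I F = (-1) ^ (\<Sum>l\<le>L. l * d l) * I (\<lambda>l. form_act g (F' l))"
    using multihomogeneous_sign[OF I(2) form_space_form_act[OF g F'], of "-1"] by simp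
  also have "I (\<lambda>l. form_act g (F' l)) = cnj (I F)"
    using invariants_act[OF I(1) g F'] real_coeffs_cnj[OF I(3) F] by (simp add: F'_def)
  finally show ?thesis
    unfolding F_def .
qed

section \<open>The action of the orthogonal group and its lift to \<open>SL2\<close>\<close>

lemma O3_act_minus_one:
  assumes "f \<in> harmonicC l"
  shows "O3_act (- mat 1) f = (\<lambda>x. (-1) ^ l * f x)"
proof
  fix x :: "complex^3"
  have inv: "matrix_inv (- mat 1 :: real^3^3) = - mat 1"
    by (intro matrix_inv_eqI) (simp add: vec_eq_iff forall_3 matrix_matrix_mult_def sum_3 mat_def)
  have "map_matrix complex_of_real (matrix_inv (- mat 1)) *v x = (-1) *s x"
    unfolding inv by (simp add: vec_eq_iff forall_3 matrix_vector_mult_def sum_3 mat_def)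
  then show "O3_act (- mat 1) f x = (-1) ^ l * f x"
    unfolding O3_act_def using harmonicC_scale[OF assms, of "-1" x] by simp
qed

lemma invariant_minus_one:
  assumes "multihomogeneous L d I" and f: "\<And>l. l \<le> L \<Longrightarrow> f l \<in> harmonicC l"
  shows "I (Psi_system L (\<lambda>l. O3_act (- mat 1) (f l))) = (-1) ^ (\<Sum>l\<le>L. l * d l) * I (Psi_system L f)"
proof -
  have "Psi_system L (\<lambda>l. O3_act (- mat 1) (f l)) = (\<lambda>l z. (-1) ^ l * Psi_system L f l z)"
    by (auto simp: fun_eq_iff Psi_system_def Psi_def O3_act_minus_one[OF f])
  then show ?thesis
    using multihomogeneous_sign[OF assms(1) Psi_system_form_space[OF f]] by simp
qed

text \<open>The double cover of the rotation group by unimodular matrices, seen on Veronese vectors.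
  The scalar \<open>e\<close>, in practice 1 or -1, also admits matrices of determinant -1.\<close>

definition lifts :: "real^3^3 \<Rightarrow> complex \<Rightarrow> bool" where
  "lifts A e \<longleftrightarrow> (\<exists>g\<in>SL2. \<forall>z. map_matrix complex_of_real A *v veronese z = e *s veronese (g *v z))"

lemma lifts_one: "lifts (mat 1) 1"
  unfolding lifts_def
proof (intro bexI[of _ "mat 1"] allI)
  have "map_matrix complex_of_real (mat 1) = (mat 1 :: complex^3^3)"
    by (simp add: vec_eq_iff mat_def)
  then show "map_matrix complex_of_real (mat 1) *v veronese z = 1 *s veronese (mat 1 *v z)" for z
    by simp
qed (simp add: SL2_def)

lemma map_matrix_of_real_mult:
  "map_matrix complex_of_real (A ** B) = map_matrix complex_of_real A ** map_matrix complex_of_real B"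
  by (simp add: vec_eq_iff matrix_matrix_mult_def)

lemma lifts_mult:
  assumes "lifts A e" "lifts B e'"
  shows "lifts (A ** B) (e * e')"
proof -
  obtain g h where g: "g \<in> SL2" "\<And>z. map_matrix complex_of_real A *v veronese z = e *s veronese (g *v z)"
    and h: "h \<in> SL2" "\<And>z. map_matrix complex_of_real B *v veronese z = e' *s veronese (h *v z)"
    using assms unfolding lifts_def by blast
  show ?thesis
    unfolding lifts_def
  proof (intro bexI[of _ "g ** h"] allI)
    fix z
    have "map_matrix complex_of_real (A ** B) *v veronese z = e' *s (e *s veronese (g *v (h *v z)))"
      by (simp add: map_matrix_of_real_mult matrix_vector_mul_assoc[symmetric] g h vector_scalar_commute)
    then show "map_matrix complex_of_real (A ** B) *v veronese z = (e * e') *s veronese ((g ** h) *v z)"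
      by (simp add: vector_smult_assoc mult.commute matrix_vector_mul_assoc)
  next
    show "g ** h \<in> SL2"
      using g(1) h(1) by (simp add: SL2_def det_mul)
  qed
qed

lemma matrix_inv_SL2_mem:
  assumes "g \<in> SL2"
  shows "matrix_inv g \<in> SL2" "matrix_inv (matrix_inv g) = g"
proof -
  show *: "matrix_inv g \<in> SL2"
    unfolding matrix_inv_SL2[OF assms] using assms by (simp add: SL2_def det_2 mult.commute)
  show "matrix_inv (matrix_inv g) = g"
    unfolding matrix_inv_SL2[OF *] by (simp add: matrix_inv_SL2[OF assms] vec_eq_iff forall_2)
qed

text \<open>A lift turns the action on harmonics into an \<open>SL2\<close> action on forms times
  \<open>e ^ l\<close>; only the scalars survive in the invariant. As \<open>form_act\<close>
  substitutes the inverse, the group element is \<open>matrix_inv g\<close>.\<close>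

lemma invariant_lifts:
  assumes I: "I \<in> invariants L" "multihomogeneous L d I"
    and f: "\<And>l. l \<le> L \<Longrightarrow> f l \<in> harmonicC l" and A: "lifts (matrix_inv A) e"
  shows "I (Psi_system L (\<lambda>l. O3_act A (f l))) = e ^ (\<Sum>l\<le>L. l * d l) * I (Psi_system L f)"
proof -
  obtain g where g: "g \<in> SL2"
    "\<And>z. map_matrix complex_of_real (matrix_inv A) *v veronese z = e *s veronese (g *v z)"
    using A unfolding lifts_def by blast
  have "Psi_system L (\<lambda>l. O3_act A (f l)) = (\<lambda>l z. e ^ l * form_act (matrix_inv g) (Psi_system L f l) z)"
    by (auto simp: fun_eq_iff Psi_system_def Psi_def O3_act_def form_act_def g(2)
        harmonicC_scale[OF f] matrix_inv_SL2_mem[OF g(1)])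
  moreover have "Psi_system L f \<in> form_space L"
    using f by (rule Psi_system_form_space)
  ultimately show ?thesis
    using multihomogeneous_sign[OF I(2), of "\<lambda>l. form_act (matrix_inv g) (Psi_system L f l)" e]
      form_space_form_act[OF matrix_inv_SL2_mem(1)[OF g(1)]]
      invariants_act[OF I(1) matrix_inv_SL2_mem(1)[OF g(1)]]
    by simp
qed

section \<open>Reflections, their lifts, and reduction of orthogonal matrices to reflections\<close>

definition reflect :: "real^3 \<Rightarrow> real^3 \<Rightarrow> real^3" where
  "reflect n x = x - (2 * (x \<bullet> n) / (n \<bullet> n)) *\<^sub>R n"

lemma linear_reflect: "linear (reflect n)"
  by (rule linearI) (simp_all add: reflect_def inner_add_left algebra_simps add_divide_distrib)

lemma reflect_matrix_vector: "matrix (reflect n) *v x = reflect n x"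
  using matrix_works[of "reflect n"] linear_reflect by (simp add: linear_matrix_vector_mul_eq)

lemma reflect_reflect: "n \<noteq> 0 \<Longrightarrow> reflect n (reflect n x) = x"
  by (simp add: reflect_def inner_diff_left)

lemma reflect_inner: "n \<noteq> 0 \<Longrightarrow> reflect n x \<bullet> reflect n y = x \<bullet> y"
  by (simp add: reflect_def inner_diff_left inner_diff_right inner_commute field_simps)

lemma reflect_matrix_involution: "n \<noteq> 0 \<Longrightarrow> matrix (reflect n) ** matrix (reflect n) = mat 1"
  unfolding matrix_eq matrix_vector_mul_assoc[symmetric] reflect_matrix_vector
  by (simp add: reflect_reflect)

lemma reflect_swaps:
  assumes "x \<bullet> x = y \<bullet> y" "x \<noteq> y"
  shows "reflect (x - y) x = y"
proof -
  have "2 * (x \<bullet> (x - y)) = (x - y) \<bullet> (x - y)"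
    using assms(1) by (simp add: inner_diff_left inner_diff_right inner_commute)
  then have "2 * (x \<bullet> (x - y)) / ((x - y) \<bullet> (x - y)) = 1"
    using assms(2) by simp
  then show ?thesis
    by (simp only: reflect_def) simp
qed

lemma reflect_scale: "r \<noteq> 0 \<Longrightarrow> reflect (r *\<^sub>R n) = reflect n"
  by (rule ext) (simp add: reflect_def)

lemma lifts_reflect_unit:
  assumes "n \<bullet> n = 1"
  shows "lifts (matrix (reflect n)) (-1)"
proof -
  define a b c where abc: "a = complex_of_real (n$1)" "b = complex_of_real (n$2)" "c = complex_of_real (n$3)"
  have "n$1 * n$1 + n$2 * n$2 + n$3 * n$3 = 1"
    using assms by (simp add: inner_vec_def sum_3)
  then have "complex_of_real (n$1 * n$1 + n$2 * n$2 + n$3 * n$3) = 1"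
    by simp
  then have norm: "a * a + b * b + c * c = 1"
    by (simp add: abc)
  \<comment> \<open>\<open>- reflect n\<close> is the half-turn about \<open>n\<close>; its lift is linear in \<open>n\<close> and has square \<open>-1\<close>\<close>
  define g :: "complex^2^2" where "g = vector [vector [\<i> * c, - (\<i> * a + b)], vector [b - \<i> * a, - \<i> * c]]"
  have g: "g \<in> SL2"
    using norm by (simp add: g_def SL2_def det_2 algebra_simps)
  have entry: "map_matrix complex_of_real (matrix (reflect n)) $ i $ j =
      (if i = j then 1 else 0) - 2 * of_real (n$i) * of_real (n$j)" for i j
    by (simp add: matrix_def reflect_def assms inner_axis') (simp add: axis_def)
  have "map_matrix complex_of_real (matrix (reflect n)) *v veronese z = (-1) *s veronese (g *v z)" for z
  proof -
    define x y i where xy: "x = z$1" "y = z$2" "i = \<i>"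
    have i: "i * i = -1" "i * (i * t) = - t" for t
      by (simp_all add: xy flip: mult.assoc)
    \<comment> \<open>Writing \<open>s\<close> for the squared norm turns the three coordinates into
      polynomial identities in \<open>a\<close>, \<open>b\<close>, \<open>c\<close>,
      \<open>x\<close>, \<open>y\<close>, with \<open>i\<close> opaque apart from its square. Only
      afterwards is \<open>s\<close> set to 1.\<close>
    have id1: "(s - 2 * a * a) * (x^2 - y^2) + (0 - 2 * a * b) * (i * (x^2 + y^2)) + (0 - 2 * a * c) * (2 * x * y) =
        - ((i * c * x - (i * a + b) * y)^2 - ((b - i * a) * x - i * c * y)^2)"
      and id2: "(0 - 2 * b * a) * (x^2 - y^2) + (s - 2 * b * b) * (i * (x^2 + y^2)) + (0 - 2 * b * c) * (2 * x * y) =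
        - (i * ((i * c * x - (i * a + b) * y)^2 + ((b - i * a) * x - i * c * y)^2))"
      and id3: "(0 - 2 * c * a) * (x^2 - y^2) + (0 - 2 * c * b) * (i * (x^2 + y^2)) + (s - 2 * c * c) * (2 * x * y) =
        - (2 * (i * c * x - (i * a + b) * y) * ((b - i * a) * x - i * c * y))"
      if "s = a * a + b * b + c * c" for s
      unfolding that by (simp_all add: power2_eq_square algebra_simps i)
    have gz: "(g *v z) $ 1 = i * c * x - (i * a + b) * y" "(g *v z) $ 2 = (b - i * a) * x - i * c * y"
      by (simp_all add: g_def xy matrix_vector_mult_def sum_2 algebra_simps)
    have M: "(map_matrix complex_of_real (matrix (reflect n)) *v veronese z) $ k =
        ((if k = 1 then 1 else 0) - 2 * of_real (n$k) * a) * (x^2 - y^2) +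
        ((if k = 2 then 1 else 0) - 2 * of_real (n$k) * b) * (i * (x^2 + y^2)) +
        ((if k = 3 then 1 else 0) - 2 * of_real (n$k) * c) * (2 * x * y)" for k
      unfolding matrix_vector_mult_def by (simp add: sum_3 entry abc xy del: nth_map_matrix)
    show ?thesis
      unfolding vec_eq_iff forall_3 vector_smult_component veronese_component gz M
      using id1[of 1] id2[of 1] id3[of 1] norm by (simp add: abc xy)
  qed
  then show ?thesis
    using g unfolding lifts_def by blast
qed

lemma lifts_reflect:
  assumes "n \<noteq> 0"
  shows "lifts (matrix (reflect n)) (-1)"
proof -
  have "reflect n = reflect ((1 / norm n) *\<^sub>R n)"
    using assms by (simp add: reflect_scale)
  moreover have "((1 / norm n) *\<^sub>R n) \<bullet> ((1 / norm n) *\<^sub>R n) = 1"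
    using assms by (simp add: power2_norm_eq_inner[symmetric] power2_eq_square)
  ultimately show ?thesis
    using lifts_reflect_unit by metis
qed

text \<open>If \<open>A\<close> moves \<open>u\<close>, the reflection in \<open>A *v u - u\<close>
  carries \<open>A *v u\<close> back to \<open>u\<close>. It fixes \<open>S\<close> because the
  vectors there are orthogonal to both. Each reflection costs one sign in
  \<open>lifts\<close>.\<close>

lemma isometry_fix_one_more:
  fixes A :: "real^3^3"
  assumes iso: "\<And>x y. (A *v x) \<bullet> (A *v y) = x \<bullet> y"
    and S: "\<And>x. x \<in> S \<Longrightarrow> A *v x = x \<and> x \<bullet> u = 0"
  shows "\<exists>B. (\<forall>x y. (B *v x) \<bullet> (B *v y) = x \<bullet> y) \<and> (\<forall>x\<in>insert u S. B *v x = x) \<and>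
    (\<forall>e. lifts B e \<longrightarrow> lifts A e \<or> lifts A (- e))"
proof (cases "A *v u = u")
  case True
  then show ?thesis
    using iso S by (intro exI[of _ A]) auto
next
  case False
  define n where "n = A *v u - u"
  have n: "n \<noteq> 0"
    using False by (simp add: n_def)
  define B where "B = matrix (reflect n) ** A"
  have B: "B *v x = reflect n (A *v x)" for x
    by (simp add: B_def reflect_matrix_vector flip: matrix_vector_mul_assoc)
  have A: "A = matrix (reflect n) ** B"
    by (simp add: B_def matrix_mul_assoc reflect_matrix_involution n)
  show ?thesis
  proof (intro exI[of _ B] conjI allI ballI impI)
    show "(B *v x) \<bullet> (B *v y) = x \<bullet> y" for x y
      by (simp add: B reflect_inner n iso)
  next
    fix x assume "x \<in> insert u S"
    moreover have "B *v u = u"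
      unfolding B n_def using False iso by (intro reflect_swaps) auto
    moreover have "B *v x = x" if "x \<in> S"
    proof -
      have "x \<bullet> (A *v u) = 0"
        using S[OF that] iso[of x u] by simp
      then have "x \<bullet> n = 0"
        using S[OF that] by (simp add: n_def inner_diff_right)
      then show ?thesis
        using S[OF that] by (simp add: B reflect_def)
    qed
    ultimately show "B *v x = x"
      by blast
  next
    fix e assume "lifts B e"
    then show "lifts A e \<or> lifts A (- e)"
      using lifts_mult[OF lifts_reflect[OF n]] A by fastforce
  qed
qed

text \<open>Applying the previous step to the three standard basis vectors ends at the identity.
  Stating both signs avoids tracking the determinant.\<close>

lemma lifts_orthogonal:
  assumes "orthogonal_matrix A"
  shows "lifts A 1 \<or> lifts A (-1)"
proof -
  have orth: "transpose A ** A = mat 1"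
    using assms by (simp add: orthogonal_matrix_def)
  have "(A *v x) \<bullet> w = x \<bullet> (transpose A *v w)" for x w
    by (metis dot_lmul_matrix vector_transpose_matrix)
  then have iso_A: "(A *v x) \<bullet> (A *v y) = x \<bullet> y" for x y
    by (simp only: matrix_vector_mul_assoc orth matrix_vector_mul_lid)
  obtain B where B: "\<forall>x y. (B *v x) \<bullet> (B *v y) = x \<bullet> y" "\<forall>x\<in>{axis 1 1}. B *v x = x"
    "\<forall>e. lifts B e \<longrightarrow> lifts A e \<or> lifts A (- e)"
    using isometry_fix_one_more[of A "{}" "axis 1 1"] iso_A by auto
  have "B *v x = x \<and> x \<bullet> axis 2 1 = 0" if "x \<in> {axis 1 1}" for x
    using B(2) that by (simp add: inner_axis_axis)
  then obtain C where C: "\<forall>x y. (C *v x) \<bullet> (C *v y) = x \<bullet> y"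
    "\<forall>x\<in>{axis 2 1, axis 1 1}. C *v x = x" "\<forall>e. lifts C e \<longrightarrow> lifts B e \<or> lifts B (- e)"
    using isometry_fix_one_more[of B "{axis 1 1}" "axis 2 1"] B(1) by blast
  have "C *v x = x \<and> x \<bullet> axis 3 1 = 0" if "x \<in> {axis 2 1, axis 1 1}" for x
    using C(2) that by (auto simp: inner_axis_axis)
  then obtain D where D: "\<forall>x\<in>{axis 3 1, axis 2 1, axis 1 1}. D *v x = x"
    "\<forall>e. lifts D e \<longrightarrow> lifts C e \<or> lifts C (- e)"
    using isometry_fix_one_more[of C "{axis 2 1, axis 1 1}" "axis 3 1"] C(1) by blast
  have "D *v axis 1 1 = axis 1 1" "D *v axis 2 1 = axis 2 1" "D *v axis 3 1 = axis 3 1"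
    using D(1) by simp_all
  then have "D = mat 1"
    by (simp add: vec_eq_iff forall_3 matrix_vector_mult_def sum_3 axis_def mat_def)
  then show ?thesis
    using lifts_one D(2) C(3) B(3) by (metis minus_minus)
qed

lemma invariant_orthogonal:
  assumes "I \<in> invariants L" "multihomogeneous L d I" "\<And>l. l \<le> L \<Longrightarrow> f l \<in> harmonicC l"
    and "even (\<Sum>l\<le>L. l * d l)" "orthogonal_matrix A"
  shows "I (Psi_system L (\<lambda>l. O3_act A (f l))) = I (Psi_system L f)"
proof -
  have "matrix_inv A = transpose A"
    using assms(5) by (intro matrix_inv_eqI) (simp add: orthogonal_matrix_def)
  then have "lifts (matrix_inv A) 1 \<or> lifts (matrix_inv A) (-1)"
    using lifts_orthogonal[of "transpose A"] assms(5) by simp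
  then show ?thesis
    using invariant_lifts[OF assms(1-3)] assms(4) by force
qed

lemma invariant_reflection:
  assumes "I \<in> invariants L" "multihomogeneous L d I" "\<And>l. l \<le> L \<Longrightarrow> f l \<in> harmonicC l"
    and "odd (\<Sum>l\<le>L. l * d l)" "is_reflection A"
  shows "I (Psi_system L (\<lambda>l. O3_act A (f l))) = - I (Psi_system L f)"
proof -
  obtain n where n: "n \<noteq> 0" "A = matrix (reflect n)"
    using assms(5) unfolding is_reflection_def reflect_def[abs_def] by blast
  then have "matrix_inv A = matrix (reflect n)"
    by (intro matrix_inv_eqI) (simp add: reflect_matrix_involution)
  then have "lifts (matrix_inv A) (-1)"
    using lifts_reflect[OF n(1)] by simp
  then show ?thesis
    using invariant_lifts[OF assms(1-3)] assms(4) by force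
qed

section \<open>Multihomogeneous components\<close>

text \<open>Replacing \<open>t l\<close> by \<open>2 * t l\<close> multiplies the \<open>d\<close>-th summand by \<open>2 ^ d l\<close>; subtracting a
  multiple of the original relation removes one chosen summand.\<close>

lemma monomials_independent:
  fixes x :: "(nat \<Rightarrow> nat) \<Rightarrow> complex"
  assumes "finite D" "\<And>d l. d \<in> D \<Longrightarrow> l > L \<Longrightarrow> d l = 0"
    and "\<And>t :: nat \<Rightarrow> complex. (\<Sum>d\<in>D. (\<Prod>l\<le>L. t l ^ d l) * x d) = 0" "d \<in> D"
  shows "x d = 0"
  using assms
proof (induction D arbitrary: x rule: finite_psubset_induct)
  case (psubset D)
  show ?case
  proof (cases "D = {d}")
    case True
    then show ?thesis
      using psubset.prems(2)[of "\<lambda>_. 1"] by simp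
  next
    case False
    then obtain e where e: "e \<in> D" "e \<noteq> d"
      using psubset.prems(3) by blast
    then obtain l where l: "e l \<noteq> d l"
      by blast
    then have "l \<le> L"
      using psubset.prems(1) psubset.prems(3) e(1) by (metis not_le)
    have scaled: "(\<Prod>k\<le>L. ((if k = l then 2 else 1) * t k) ^ c k) = 2 ^ c l * (\<Prod>k\<le>L. t k ^ c k)"
      for t :: "nat \<Rightarrow> complex" and c :: "nat \<Rightarrow> nat"
    proof -
      have "(\<Prod>k\<le>L. (if k = l then 2 else 1 :: complex) ^ c k) = (\<Prod>k\<le>L. if k = l then 2 ^ c k else 1)"
        by (intro prod.cong) auto
      then show ?thesis
        using \<open>l \<le> L\<close> by (simp add: power_mult_distrib prod.distrib prod.delta)
    qed
    have "(2 ^ d l - 2 ^ e l) * x d = 0"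
    proof (rule psubset.IH[of "D - {e}" "\<lambda>c. (2 ^ c l - 2 ^ e l) * x c"])
      fix t :: "nat \<Rightarrow> complex"
      have "(\<Sum>c\<in>D - {e}. (\<Prod>k\<le>L. t k ^ c k) * ((2 ^ c l - 2 ^ e l) * x c)) =
        (\<Sum>c\<in>D. (\<Prod>k\<le>L. t k ^ c k) * ((2 ^ c l - 2 ^ e l) * x c))"
        using psubset.hyps e(1) by (intro sum.mono_neutral_left) auto
      also have "\<dots> = (\<Sum>c\<in>D. (\<Prod>k\<le>L. ((if k = l then 2 else 1) * t k) ^ c k) * x c)
          - 2 ^ e l * (\<Sum>c\<in>D. (\<Prod>k\<le>L. t k ^ c k) * x c)"
        unfolding scaled by (simp add: sum_distrib_left algebra_simps flip: sum_subtractf)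
      also have "\<dots> = 0"
        using psubset.prems(2)[of t] psubset.prems(2)[of "\<lambda>k. (if k = l then 2 else 1) * t k"] by simp
      finally show "(\<Sum>c\<in>D - {e}. (\<Prod>k\<le>L. t k ^ c k) * ((2 ^ c l - 2 ^ e l) * x c)) = 0" .
    qed (use e psubset.prems in auto)
    moreover have "(2 :: complex) ^ d l \<noteq> 2 ^ e l"
    proof
      assume "(2 :: complex) ^ d l = 2 ^ e l"
      then have "of_nat (2 ^ d l) = (of_nat (2 ^ e l) :: complex)"
        by simp
      then have "(2 :: nat) ^ d l = 2 ^ e l"
        using of_nat_eq_iff by blast
      then show False
        using l by simp
    qed
    ultimately show ?thesis
      by simp
  qed
qed

section \<open>Polynomial functions of the coefficients\<close>

lemma forms_of_coeffs_inject:
  assumes "forms_of_coeffs L a = forms_of_coeffs L b" "l \<le> L" "k \<le> 2 * l"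
  shows "a l k = b l k"
  using fun_cong[OF assms(1), of l] assms(2,3) binary_form_inject by (simp add: forms_of_coeffs_def)

lemma poly_functions_expand:
  assumes "I \<in> poly_functions UNIV L"
  shows "\<exists>M c. finite M \<and> (\<forall>a. I (forms_of_coeffs L a) = (\<Sum>m\<in>M. c m * (\<Prod>l\<le>L. \<Prod>k\<le>2 * l. a l k ^ m l k)))"
  using assms unfolding poly_functions_def by simp

lemma poly_functions_zero: "(\<lambda>F. 0) \<in> poly_functions UNIV L"
  unfolding poly_functions_def by (auto intro!: exI[of _ "{}"])

lemma poly_functions_add:
  assumes "I \<in> poly_functions UNIV L" "J \<in> poly_functions UNIV L"
  shows "(\<lambda>F. I F + J F) \<in> poly_functions UNIV L"
proof -
  obtain M c where M: "finite M"
    and I: "\<forall>a. I (forms_of_coeffs L a) = (\<Sum>m\<in>M. c m * (\<Prod>l\<le>L. \<Prod>k\<le>2 * l. a l k ^ m l k))"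
    using poly_functions_expand[OF assms(1)] by blast
  obtain N d where N: "finite N"
    and J: "\<forall>a. J (forms_of_coeffs L a) = (\<Sum>m\<in>N. d m * (\<Prod>l\<le>L. \<Prod>k\<le>2 * l. a l k ^ m l k))"
    using poly_functions_expand[OF assms(2)] by blast
  define e where "e = (\<lambda>m. (if m \<in> M then c m else 0) + (if m \<in> N then d m else 0))"
  have "I (forms_of_coeffs L a) + J (forms_of_coeffs L a) =
      (\<Sum>m\<in>M \<union> N. e m * (\<Prod>l\<le>L. \<Prod>k\<le>2 * l. a l k ^ m l k))" for a
  proof -
    have "I (forms_of_coeffs L a) = (\<Sum>m\<in>M \<union> N. (if m \<in> M then c m else 0) * (\<Prod>l\<le>L. \<Prod>k\<le>2 * l. a l k ^ m l k))"
      unfolding I[rule_format] using M N by (intro sum.mono_neutral_cong_left) auto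
    moreover have "J (forms_of_coeffs L a) = (\<Sum>m\<in>M \<union> N. (if m \<in> N then d m else 0) * (\<Prod>l\<le>L. \<Prod>k\<le>2 * l. a l k ^ m l k))"
      unfolding J[rule_format] using M N by (intro sum.mono_neutral_cong_left) auto
    ultimately show ?thesis
      by (simp only: e_def distrib_right sum.distrib)
  qed
  moreover have "I F + J F = 0" if "F \<notin> form_space L" for F
    using assms that by (simp add: poly_functions_def)
  ultimately show ?thesis
    unfolding poly_functions_def using M N by blast
qed

lemma invariants_sum:
  assumes "\<And>i. i \<in> S \<Longrightarrow> J i \<in> invariants L"
  shows "(\<lambda>F. \<Sum>i\<in>S. J i F) \<in> invariants L"
  using assms
proof (induction S rule: infinite_finite_induct)
  case (insert i S)
  then have "J i \<in> invariants L" "(\<lambda>F. \<Sum>i\<in>S. J i F) \<in> invariants L"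
    by auto
  then have "(\<lambda>F. J i F + (\<Sum>i\<in>S. J i F)) \<in> invariants L"
    using poly_functions_add by (simp add: invariants_def)
  then show ?case
    using insert.hyps by simp
qed (simp_all add: invariants_def poly_functions_zero)

section \<open>Existence, uniqueness and invariance of the components\<close>

lemma mh_sum_superset:
  fixes C :: "(nat \<Rightarrow> nat) \<Rightarrow> form_system \<Rightarrow> complex"
  assumes "finite S" "\<And>d. C d \<noteq> (\<lambda>F. 0) \<Longrightarrow> d \<in> S"
  shows "(\<Sum>d | C d \<noteq> (\<lambda>F. 0) \<and> P d. C d F) = (\<Sum>d\<in>S. if P d then C d F else 0)"
  using assms by (intro sum.mono_neutral_cong_left) (auto simp: fun_eq_iff)

lemma mh_components_sum:
  assumes "is_mh_components L I C" "finite S" "\<And>d. C d \<noteq> (\<lambda>F. 0) \<Longrightarrow> d \<in> S"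
  shows "I F = (\<Sum>d\<in>S. C d F)"
  using assms(1) mh_sum_superset[OF assms(2,3), where P = "\<lambda>d. True"] by (simp add: is_mh_components_def)

lemma mh_components_scale:
  assumes C: "is_mh_components L I C" and S: "finite S" "\<And>d. C d \<noteq> (\<lambda>F. 0) \<Longrightarrow> d \<in> S"
    and F: "F \<in> form_space L"
  shows "I (\<lambda>l z. t l * F l z) = (\<Sum>d\<in>S. (\<Prod>l\<le>L. t l ^ d l) * C d F)"
proof -
  have "C d (\<lambda>l z. t l * F l z) = (\<Prod>l\<le>L. t l ^ d l) * C d F" for d
    using C F unfolding is_mh_components_def multihomogeneous_def by blast
  then show ?thesis
    using mh_components_sum[OF C S] by simp
qed

text \<open>Both rescaled values are polynomials in the \<open>t l\<close> whose coefficients are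
  the components, so these agree. Allowing two functions and two arguments covers uniqueness, with
  \<open>F = G\<close>, as well as invariance, with \<open>F\<close> a transform of
  \<open>G\<close>.\<close>

lemma mh_components_eqI:
  assumes C: "is_mh_components L I C" and C': "is_mh_components L J C'"
    and F: "F \<in> form_space L" and G: "G \<in> form_space L"
    and eq: "\<And>t. I (\<lambda>l z. t l * F l z) = J (\<lambda>l z. t l * G l z)"
  shows "C d F = C' d G"
proof -
  define S where "S = {d. C d \<noteq> (\<lambda>F. 0)} \<union> {d. C' d \<noteq> (\<lambda>F. 0)}"
  have fin: "finite S"
    using C C' by (simp add: S_def is_mh_components_def)
  have S: "C d \<noteq> (\<lambda>F. 0) \<Longrightarrow> d \<in> S" "C' d \<noteq> (\<lambda>F. 0) \<Longrightarrow> d \<in> S" for d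
    by (auto simp: S_def)
  show ?thesis
  proof (cases "d \<in> S")
    case True
    have "C d F - C' d G = 0"
    proof (rule monomials_independent[OF fin _ _ True])
      show "(\<Sum>d\<in>S. (\<Prod>l\<le>L. t l ^ d l) * (C d F - C' d G)) = 0" for t
        using eq[of t] mh_components_scale[OF C fin S(1) F] mh_components_scale[OF C' fin S(2) G]
        by (simp add: right_diff_distrib sum_subtractf)
      show "e l = 0" if "e \<in> S" "l > L" for e l
        using C C' that unfolding S_def is_mh_components_def by blast
    qed
    then show ?thesis
      by simp
  next
    case False
    then have "C d = (\<lambda>F. 0)" "C' d = (\<lambda>F. 0)"
      using S by blast+
    then show ?thesis
      by simp
  qed
qed

lemma mh_components_unique:
  assumes C: "is_mh_components L I C" and C': "is_mh_components L I C'"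
  shows "C = C'"
proof (intro ext)
  fix d F
  show "C d F = C' d F"
  proof (cases "F \<in> form_space L")
    case True
    then show ?thesis
      using mh_components_eqI[OF C C'] by blast
  next
    case False
    then show ?thesis
      using C C' by (simp add: is_mh_components_def poly_functions_def)
  qed
qed

lemma mh_components_eq: "is_mh_components L I C \<Longrightarrow> mh_components L I = C"
  unfolding mh_components_def using mh_components_unique by blast

lemma mh_components_exist:
  assumes "I \<in> poly_functions UNIV L"
  shows "\<exists>C. is_mh_components L I C"
proof -
  obtain M c where M: "finite M"
    and I: "\<forall>a. I (forms_of_coeffs L a) = (\<Sum>m\<in>M. c m * (\<Prod>l\<le>L. \<Prod>k\<le>2 * l. a l k ^ m l k))"
    using poly_functions_expand[OF assms] by blast
  define mono where "mono = (\<lambda>(a :: nat \<Rightarrow> nat \<Rightarrow> complex) m. \<Prod>l\<le>L. \<Prod>k\<le>2 * l. a l k ^ (m l k :: nat))"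
  \<comment> \<open>The multidegree of a monomial, set to 0 beyond \<open>L\<close> to match the
    normalisation in \<open>is_mh_components\<close>.\<close>
  define deg where "deg = (\<lambda>m l. if l \<le> L then \<Sum>k\<le>2 * l. m l k :: nat else 0)"
  \<comment> \<open>An arbitrary choice of coefficients; it is undetermined only at indices that no
    \<open>mono\<close> involves.\<close>
  define coeffs where "coeffs = (\<lambda>F. SOME a. F = forms_of_coeffs L a)"
  define C where "C = (\<lambda>d F. if F \<in> form_space L then \<Sum>m | m \<in> M \<and> deg m = d. c m * mono (coeffs F) m else 0)"
  have "mono (coeffs (forms_of_coeffs L a)) m = mono a m" for a m
  proof -
    have "forms_of_coeffs L a = forms_of_coeffs L (coeffs (forms_of_coeffs L a))"
      unfolding coeffs_def by (rule someI[of "\<lambda>b. forms_of_coeffs L a = forms_of_coeffs L b" a]) simp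
    note inject = forms_of_coeffs_inject[OF this, symmetric]
    show ?thesis
      unfolding mono_def by (intro prod.cong refl) (simp add: inject)
  qed
  then have C: "C d (forms_of_coeffs L a) = (\<Sum>m | m \<in> M \<and> deg m = d. c m * mono a m)" for d a
    using form_space_iff by (auto simp: C_def)
  have supp: "d \<in> deg ` M" if "C d \<noteq> (\<lambda>F. 0)" for d
  proof (rule ccontr)
    assume "d \<notin> deg ` M"
    then have "{m. m \<in> M \<and> deg m = d} = {}"
      by auto
    then have "C d = (\<lambda>F. 0)"
      unfolding C_def by (simp only: sum.empty if_cancel)
    with that show False ..
  qed
  have scale: "mono (\<lambda>l k. t l * a l k) m = (\<Prod>l\<le>L. t l ^ deg m l) * mono a m" for t a m
    by (simp add: mono_def deg_def power_mult_distrib prod.distrib power_sum)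
  have "is_mh_components L I C"
    unfolding is_mh_components_def
  proof (intro conjI allI impI)
    fix d
    show "C d \<in> poly_functions UNIV L"
      unfolding poly_functions_def
    proof (intro CollectI conjI allI impI exI)
      show "C d (forms_of_coeffs L a) = (\<Sum>m | m \<in> M \<and> deg m = d. c m * (\<Prod>l\<le>L. \<Prod>k\<le>2 * l. a l k ^ m l k))" for a
        by (simp add: C mono_def)
    qed (use M in \<open>auto simp: C_def\<close>)
    show "multihomogeneous L d (C d)"
      unfolding multihomogeneous_def
    proof (intro allI ballI)
      fix t :: "nat \<Rightarrow> complex" and F assume "F \<in> form_space L"
      then obtain a where a: "F = forms_of_coeffs L a"
        using form_space_iff by blast
      then have "(\<lambda>l z. t l * F l z) = forms_of_coeffs L (\<lambda>l k. t l * a l k)"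
        by (auto simp: fun_eq_iff forms_of_coeffs_def binary_form_def sum_distrib_left mult_ac)
      then show "C d (\<lambda>l z. t l * F l z) = (\<Prod>l\<le>L. t l ^ d l) * C d F"
        unfolding a by (simp add: C scale sum_distrib_left mult_ac)
    qed
  next
    show "finite {d. C d \<noteq> (\<lambda>F. 0)}"
      using supp M by (intro finite_subset[OF _ finite_imageI[OF M]]) blast
  next
    fix d l assume "C d \<noteq> (\<lambda>F. 0)" "l > L"
    then show "d l = 0"
      using supp by (force simp: deg_def)
  next
    fix F
    have "(\<Sum>d | C d \<noteq> (\<lambda>F. 0). C d F) = (\<Sum>d\<in>deg ` M. C d F)"
      using M supp by (intro sum.mono_neutral_left) (auto simp: fun_eq_iff)
    also have "\<dots> = I F"
    proof (cases "F \<in> form_space L")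
      case True
      then obtain a where a: "F = forms_of_coeffs L a"
        using form_space_iff by blast
      have "(\<Sum>d\<in>deg ` M. C d F) = (\<Sum>d\<in>deg ` M. \<Sum>m | m \<in> M \<and> deg m = d. c m * mono a m)"
        by (simp only: a C)
      also have "\<dots> = (\<Sum>m\<in>M. c m * mono a m)"
        by (rule sum.group) (use M in auto)
      finally show ?thesis
        by (simp add: a I mono_def)
    next
      case False
      then show ?thesis
        using assms by (simp add: C_def poly_functions_def)
    qed
    finally show "I F = (\<Sum>d | C d \<noteq> (\<lambda>F. 0). C d F)" ..
  qed
  then show ?thesis
    by blast
qed

text \<open>Rescaling the forms commutes with the group action, so \<open>F\<close> and its
  transform have the same rescaled values.\<close>

lemma mh_components_invariant:
  assumes I: "I \<in> invariants L" and C: "is_mh_components L I C"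
  shows "C d \<in> invariants L"
proof -
  have "C d (\<lambda>l. form_act g (F l)) = C d F" if g: "g \<in> SL2" and F: "F \<in> form_space L" for g F
  proof (rule mh_components_eqI[OF C C form_space_form_act[OF g F] F])
    fix t :: "nat \<Rightarrow> complex"
    have "(\<lambda>l z. t l * form_act g (F l) z) = (\<lambda>l. form_act g (\<lambda>z. t l * F l z))"
      by (simp add: form_act_def fun_eq_iff)
    then show "I (\<lambda>l z. t l * form_act g (F l) z) = I (\<lambda>l z. t l * F l z)"
      using invariants_act[OF I g form_space_scale[OF F]] by simp
  qed
  then show ?thesis
    using C by (simp add: invariants_def is_mh_components_def)
qed

section \<open>Even and odd parts of invariants\<close>

text \<open>Used with \<open>P\<close> selecting even or odd weight. It identifies the components of
  a part, so that taking the same part again changes nothing.\<close>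

lemma is_mh_components_part:
  assumes C: "is_mh_components L I C"
  shows "is_mh_components L (\<lambda>F. \<Sum>d | C d \<noteq> (\<lambda>F. 0) \<and> P d. C d F) (\<lambda>d. if P d then C d else (\<lambda>F. 0))"
  unfolding is_mh_components_def
proof (intro conjI allI impI)
  fix d
  show "(if P d then C d else (\<lambda>F. 0)) \<in> poly_functions UNIV L"
    using C by (simp add: is_mh_components_def poly_functions_zero)
  show "multihomogeneous L d (if P d then C d else (\<lambda>F. 0))"
    using C by (simp add: is_mh_components_def multihomogeneous_def)
next
  have "finite {d. C d \<noteq> (\<lambda>F. 0)}"
    using C by (simp add: is_mh_components_def)
  then show "finite {d. (if P d then C d else (\<lambda>F. 0)) \<noteq> (\<lambda>F. 0)}"
    by (rule rev_finite_subset) auto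
next
  fix d l assume "(if P d then C d else (\<lambda>F. 0)) \<noteq> (\<lambda>F. 0)" "l > L"
  then show "d l = 0"
    using C unfolding is_mh_components_def by metis
next
  fix F
  have "{d. (if P d then C d else (\<lambda>F. 0)) \<noteq> (\<lambda>F. 0)} = {d. C d \<noteq> (\<lambda>F. 0) \<and> P d}"
    by auto
  then show "(\<Sum>d | C d \<noteq> (\<lambda>F. 0) \<and> P d. C d F) =
      (\<Sum>d | (if P d then C d else (\<lambda>F. 0)) \<noteq> (\<lambda>F. 0). (if P d then C d else (\<lambda>F. 0)) F)"
    by (intro sum.cong) auto
qed

lemma even_part_eq:
  assumes "is_mh_components L I C"
  shows "even_part L I = (\<lambda>F. \<Sum>d | C d \<noteq> (\<lambda>F. 0) \<and> even (weight L d). C d F)"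
  unfolding even_part_def[abs_def] mh_components_eq[OF assms] ..

lemma odd_part_eq:
  assumes "is_mh_components L I C"
  shows "odd_part L I = (\<lambda>F. \<Sum>d | C d \<noteq> (\<lambda>F. 0) \<and> odd (weight L d). C d F)"
  unfolding odd_part_def[abs_def] mh_components_eq[OF assms] ..

lemma part_invariant:
  assumes "I \<in> invariants L" "is_mh_components L I C"
  shows "(\<lambda>F. \<Sum>d | C d \<noteq> (\<lambda>F. 0) \<and> P d. C d F) \<in> invariants L"
  using mh_components_invariant[OF assms] by (rule invariants_sum)

lemma restricted_support:
  "{d. (if P d then C d else (\<lambda>F. 0)) \<noteq> (\<lambda>F. 0) \<and> P d} = {d. C d \<noteq> (\<lambda>F. 0) \<and> P d}"
  by auto

lemma even_part_even_invariant:
  assumes "I \<in> invariants L" "is_mh_components L I C"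
  shows "even_part L I \<in> even_invariants L"
  using part_invariant[OF assms, of "\<lambda>d. even (weight L d)"]
    even_part_eq[OF is_mh_components_part[OF assms(2), of "\<lambda>d. even (weight L d)"]]
  unfolding even_invariants_def even_part_eq[OF assms(2)]
  by (auto simp: restricted_support fun_eq_iff intro!: sum.cong)

lemma odd_part_odd_invariant:
  assumes "I \<in> invariants L" "is_mh_components L I C"
  shows "odd_part L I \<in> odd_invariants L"
  using part_invariant[OF assms, of "\<lambda>d. odd (weight L d)"]
    odd_part_eq[OF is_mh_components_part[OF assms(2), of "\<lambda>d. odd (weight L d)"]]
  unfolding odd_invariants_def odd_part_eq[OF assms(2)]
  by (auto simp: restricted_support fun_eq_iff intro!: sum.cong)

lemma even_part_plus_odd_part:
  assumes C: "is_mh_components L I C"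
  shows "I = (\<lambda>F. even_part L I F + odd_part L I F)"
proof
  fix F
  let ?S = "{d. C d \<noteq> (\<lambda>F. 0)}"
  have fin: "finite ?S"
    using C by (simp add: is_mh_components_def)
  have "even_part L I F + odd_part L I F =
      (\<Sum>d\<in>?S. if even (weight L d) then C d F else 0) + (\<Sum>d\<in>?S. if odd (weight L d) then C d F else 0)"
    unfolding even_part_eq[OF C] odd_part_eq[OF C]
    using mh_sum_superset[OF fin, where C = C and F = F and P = "\<lambda>d. even (weight L d)"]
      mh_sum_superset[OF fin, where C = C and F = F and P = "\<lambda>d. odd (weight L d)"] by simp
  also have "\<dots> = (\<Sum>d\<in>?S. C d F)"
    unfolding sum.distrib[symmetric] by (intro sum.cong) auto
  also have "\<dots> = I F"
    using C by (simp add: is_mh_components_def)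
  finally show "I F = even_part L I F + odd_part L I F" ..
qed

text \<open>The components of \<open>E\<close> have even weight and those of \<open>D\<close> odd
  weight, so together they are the components of the sum, which are unique.\<close>

lemma even_odd_decomposition_unique:
  assumes E: "E \<in> even_invariants L" and D: "D \<in> odd_invariants L" and I: "I = (\<lambda>F. E F + D F)"
  shows "E = even_part L I" "D = odd_part L I"
proof -
  have "E \<in> poly_functions UNIV L" "D \<in> poly_functions UNIV L"
    using E D by (simp_all add: even_invariants_def odd_invariants_def invariants_def)
  then obtain CE CD where CE: "is_mh_components L E CE" and CD: "is_mh_components L D CD"
    using mh_components_exist by meson
  have "even_part L E = E" "odd_part L D = D"
    using E D by (auto simp: even_invariants_def odd_invariants_def)
  then have "is_mh_components L E (\<lambda>d. if even (weight L d) then CE d else (\<lambda>F. 0))"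
    "is_mh_components L D (\<lambda>d. if odd (weight L d) then CD d else (\<lambda>F. 0))"
    using is_mh_components_part[OF CE, of "\<lambda>d. even (weight L d)"]
      is_mh_components_part[OF CD, of "\<lambda>d. odd (weight L d)"]
    by (simp_all only: even_part_eq[OF CE, symmetric] odd_part_eq[OF CD, symmetric])
  \<comment> \<open>Since \<open>E\<close> is its own even part, its components coincide with their
    restriction to even weight; likewise for \<open>D\<close> and odd weight.\<close>
  note eq = mh_components_unique[OF CE this(1)] mh_components_unique[OF CD this(2)]
  have CE_odd: "CE d = (\<lambda>F. 0)" if "odd (weight L d)" for d
    using fun_cong[OF eq(1), of d] that by (simp only: if_False)
  have CD_even: "CD d = (\<lambda>F. 0)" if "even (weight L d)" for d
    using fun_cong[OF eq(2), of d] that by (simp only: not_True_eq_False if_False)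
  define C where "C = (\<lambda>d. if even (weight L d) then CE d else CD d)"
  define S where "S = {d. CE d \<noteq> (\<lambda>F. 0)} \<union> {d. CD d \<noteq> (\<lambda>F. 0)}"
  have fin: "finite S"
    using CE CD by (simp add: S_def is_mh_components_def)
  have S: "CE d \<noteq> (\<lambda>F. 0) \<Longrightarrow> d \<in> S" "CD d \<noteq> (\<lambda>F. 0) \<Longrightarrow> d \<in> S" "C d \<noteq> (\<lambda>F. 0) \<Longrightarrow> d \<in> S" for d
    by (auto simp: S_def C_def split: if_splits)
  have E_sum: "E F = (\<Sum>d\<in>S. CE d F)" and D_sum: "D F = (\<Sum>d\<in>S. CD d F)" for F
    by (rule mh_components_sum[OF CE fin S(1)] mh_components_sum[OF CD fin S(2)], assumption)+
  have C: "is_mh_components L I C"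
    unfolding is_mh_components_def
  proof (intro conjI allI impI)
    fix d
    show "C d \<in> poly_functions UNIV L" "multihomogeneous L d (C d)"
      using CE CD by (simp_all add: C_def is_mh_components_def)
  next
    show "finite {d. C d \<noteq> (\<lambda>F. 0)}"
      using S(3) by (intro finite_subset[OF _ fin]) blast
  next
    fix d l assume "C d \<noteq> (\<lambda>F. 0)" "l > L"
    then show "d l = 0"
      using CE CD unfolding C_def is_mh_components_def by (metis (full_types))
  next
    fix F
    have "I F = (\<Sum>d\<in>S. CE d F + CD d F)"
      by (simp add: I E_sum D_sum sum.distrib)
    also have "\<dots> = (\<Sum>d\<in>S. C d F)"
      by (intro sum.cong) (auto simp: C_def CE_odd CD_even)
    also have "\<dots> = (\<Sum>d | C d \<noteq> (\<lambda>F. 0). C d F)"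
      using mh_sum_superset[OF fin S(3), where P = "\<lambda>d. True"] by simp
    finally show "I F = (\<Sum>d | C d \<noteq> (\<lambda>F. 0). C d F)" .
  qed
  have "even_part L I F = (\<Sum>d\<in>S. if even (weight L d) then C d F else 0)"
    "odd_part L I F = (\<Sum>d\<in>S. if odd (weight L d) then C d F else 0)" for F
    unfolding even_part_eq[OF C] odd_part_eq[OF C] by (rule mh_sum_superset[OF fin S(3)], assumption)+
  then show "E = even_part L I" "D = odd_part L I"
    unfolding fun_eq_iff E_sum D_sum by (auto intro!: sum.cong simp: C_def CE_odd CD_even)
qed

lemma is_mh_components_ex1: "I \<in> poly_functions UNIV L \<Longrightarrow> \<exists>!C. is_mh_components L I C"
  using mh_components_exist mh_components_unique by blast

theorem lemma3p6:
  shows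
  "(\<comment> \<open>(i)\<close>
    \<forall>l. real_structure (Sym (2 * l)) (sigma_conj l) \<and>
        (\<forall>g\<in>SU2. \<forall>F\<in>Sym (2 * l). sigma_conj l (form_act g F) = form_act g (sigma_conj l F)) \<and>
        (\<forall>f\<in>harmonicC l. Psi (conj_poly f) = sigma_conj l (Psi f)) \<and>
        Psi ` harmonicR l = Fix (Sym (2 * l)) (sigma_conj l)) \<and>
   (\<comment> \<open>(ii)\<close>
    \<forall>l. \<forall>F\<in>Sym (2 * l). F \<noteq> (\<lambda>z. 0) \<longrightarrow>
        ((\<exists>c. \<exists>G\<in>Fix (Sym (2 * l)) (sigma_conj l). F = (\<lambda>z. c * G z)) \<longleftrightarrow>
           antipodal_invariant (root_divisor (2 * l) F)) \<and>
        (antipodal_invariant (root_divisor (2 * l) F) \<longrightarrow>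
          (let factorization = (\<lambda>(lam :: complex) (as :: (real^3) list).
                 lam \<noteq> 0 \<and> length as = l \<and> 0 \<notin> set as \<and>
                 F = (\<lambda>z. lam * (\<Prod>a\<leftarrow>as. Qform (complexify a) z)))
           in (\<exists>lam as. factorization lam as) \<and>
              (\<forall>lam as lam' as'. factorization lam as \<longrightarrow> factorization lam' as' \<longrightarrow>
                 mset (map (\<lambda>a. span {a}) as) = mset (map (\<lambda>a. span {a}) as')) \<and>
              (\<forall>lam as. factorization lam as \<longrightarrow>
                 (lam \<in> \<real> \<longleftrightarrow> F \<in> Fix (Sym (2 * l)) (sigma_conj l)))))) \<and>
   (\<comment> \<open>(iii)\<close>
    \<forall>L d. \<forall>I\<in>invariants L. multihomogeneous L d I \<and> real_coeffs L I \<longrightarrow>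
        (\<forall>f. (\<forall>l\<le>L. f l \<in> harmonicR l) \<longrightarrow>
           I (Psi_system L f) = (-1) ^ (\<Sum>l\<le>L. l * d l) * cnj (I (Psi_system L f)))) \<and>
   (\<comment> \<open>(iv)\<close>
    (\<forall>l. \<forall>f\<in>harmonicC l. O3_act (- mat 1) f = (\<lambda>x. (-1) ^ l * f x)) \<and>
    (\<forall>L d. \<forall>I\<in>invariants L. multihomogeneous L d I \<and> real_coeffs L I \<longrightarrow>
        (\<forall>f. (\<forall>l\<le>L. f l \<in> harmonicC l) \<longrightarrow>
           I (Psi_system L (\<lambda>l. O3_act (- mat 1) (f l))) =
             (-1) ^ (\<Sum>l\<le>L. l * d l) * I (Psi_system L f) \<and>
           (even (\<Sum>l\<le>L. l * d l) \<longrightarrow>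
              (\<forall>A. orthogonal_matrix A \<longrightarrow>
                 I (Psi_system L (\<lambda>l. O3_act A (f l))) = I (Psi_system L f))) \<and>
           (odd (\<Sum>l\<le>L. l * d l) \<longrightarrow>
              (\<forall>A. is_reflection A \<longrightarrow>
                 I (Psi_system L (\<lambda>l. O3_act A (f l))) = - I (Psi_system L f))))) \<and>
    (\<forall>L. \<forall>I\<in>invariants L.
        (\<exists>!C. is_mh_components L I C) \<and>
        even_part L I \<in> even_invariants L \<and> odd_part L I \<in> odd_invariants L \<and>
        I = (\<lambda>F. even_part L I F + odd_part L I F) \<and>
        (\<forall>E\<in>even_invariants L. \<forall>D\<in>odd_invariants L. I = (\<lambda>F. E F + D F) \<longrightarrow>
           E = even_part L I \<and> D = odd_part L I)))"
proof (intro conjI allI ballI impI)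
  fix l
  show "real_structure (Sym (2 * l)) (sigma_conj l)"
    by (rule real_structure_sigma_conj)
  show "sigma_conj l (form_act g F) = form_act g (sigma_conj l F)" if "g \<in> SU2" for g F
    using that by (rule sigma_conj_form_act)
  show "Psi (conj_poly f) = sigma_conj l (Psi f)" if "f \<in> harmonicC l" for f
    using that by (rule Psi_conj_poly)
  show "Psi ` harmonicR l = Fix (Sym (2 * l)) (sigma_conj l)"
    by (rule Psi_harmonicR)
next
  fix l F assume F: "F \<in> Sym (2 * l)" "F \<noteq> (\<lambda>z. 0)"
  show "(\<exists>c. \<exists>G\<in>Fix (Sym (2 * l)) (sigma_conj l). F = (\<lambda>z. c * G z)) \<longleftrightarrow>
      antipodal_invariant (root_divisor (2 * l) F)"
    by (rule antipodal_iff_multiple_of_fixed[OF F])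
  assume inv: "antipodal_invariant (root_divisor (2 * l) F)"
  show "let factorization = (\<lambda>(lam :: complex) (as :: (real^3) list).
           lam \<noteq> 0 \<and> length as = l \<and> 0 \<notin> set as \<and>
           F = (\<lambda>z. lam * (\<Prod>a\<leftarrow>as. Qform (complexify a) z)))
     in (\<exists>lam as. factorization lam as) \<and>
        (\<forall>lam as lam' as'. factorization lam as \<longrightarrow> factorization lam' as' \<longrightarrow>
           mset (map (\<lambda>a. span {a}) as) = mset (map (\<lambda>a. span {a}) as')) \<and>
        (\<forall>lam as. factorization lam as \<longrightarrow>
           (lam \<in> \<real> \<longleftrightarrow> F \<in> Fix (Sym (2 * l)) (sigma_conj l)))"
    unfolding Let_def
  proof (intro conjI allI impI)
    show "\<exists>lam as. lam \<noteq> 0 \<and> length as = l \<and> 0 \<notin> set as \<and>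
        F = (\<lambda>z. lam * (\<Prod>a\<leftarrow>as. Qform (complexify a) z))"
      by (rule antipodal_factorization[OF F inv])
  next
    fix lam lam' :: complex and as as' :: "(real^3) list"
    assume as: "lam \<noteq> 0 \<and> length as = l \<and> 0 \<notin> set as \<and> F = (\<lambda>z. lam * (\<Prod>a\<leftarrow>as. Qform (complexify a) z))"
      "lam' \<noteq> 0 \<and> length as' = l \<and> 0 \<notin> set as' \<and> F = (\<lambda>z. lam' * (\<Prod>a\<leftarrow>as'. Qform (complexify a) z))"
    then have "(\<lambda>z. lam * (\<Prod>a\<leftarrow>as. Qform (complexify a) z)) = (\<lambda>z. lam' * (\<Prod>a\<leftarrow>as'. Qform (complexify a) z))"
      by simp
    with as show "mset (map (\<lambda>a. span {a}) as) = mset (map (\<lambda>a. span {a}) as')"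
      by (intro factorization_unique[of as as' lam lam']) auto
  next
    fix lam :: complex and as :: "(real^3) list"
    assume "lam \<noteq> 0 \<and> length as = l \<and> 0 \<notin> set as \<and> F = (\<lambda>z. lam * (\<Prod>a\<leftarrow>as. Qform (complexify a) z))"
    then show "lam \<in> \<real> \<longleftrightarrow> F \<in> Fix (Sym (2 * l)) (sigma_conj l)"
      using factor_real_iff_fixed[OF F] by blast
  qed
next
  fix L d I f
  assume I: "I \<in> invariants L" "multihomogeneous L d I \<and> real_coeffs L I"
  show "I (Psi_system L f) = (-1) ^ (\<Sum>l\<le>L. l * d l) * cnj (I (Psi_system L f))"
    if "\<forall>l\<le>L. f l \<in> harmonicR l"
    using invariant_real_harmonics[of I L d f] I that by blast
  assume f: "\<forall>l\<le>L. f l \<in> harmonicC l"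
  show "I (Psi_system L (\<lambda>l. O3_act (- mat 1) (f l))) = (-1) ^ (\<Sum>l\<le>L. l * d l) * I (Psi_system L f)"
    using invariant_minus_one[of L d I f] I f by blast
  show "I (Psi_system L (\<lambda>l. O3_act A (f l))) = I (Psi_system L f)"
    if "even (\<Sum>l\<le>L. l * d l)" "orthogonal_matrix A" for A
    using invariant_orthogonal[of I L d f A] I f that by blast
  show "I (Psi_system L (\<lambda>l. O3_act A (f l))) = - I (Psi_system L f)"
    if "odd (\<Sum>l\<le>L. l * d l)" "is_reflection A" for A
    using invariant_reflection[of I L d f A] I f that by blast
next
  show "O3_act (- mat 1) f = (\<lambda>x. (-1) ^ l * f x)" if "f \<in> harmonicC l" for l f
    using that by (rule O3_act_minus_one)
next
  fix L I assume I: "I \<in> invariants L"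
  then have poly: "I \<in> poly_functions UNIV L"
    by (simp add: invariants_def)
  then obtain C where C: "is_mh_components L I C"
    using mh_components_exist by blast
  show "\<exists>!C. is_mh_components L I C"
    by (rule is_mh_components_ex1[OF poly])
  show "even_part L I \<in> even_invariants L"
    by (rule even_part_even_invariant[OF I C])
  show "odd_part L I \<in> odd_invariants L"
    by (rule odd_part_odd_invariant[OF I C])
  show "I = (\<lambda>F. even_part L I F + odd_part L I F)"
    by (rule even_part_plus_odd_part[OF C])
  show "E = even_part L I" "D = odd_part L I"
    if "E \<in> even_invariants L" "D \<in> odd_invariants L" "I = (\<lambda>F. E F + D F)" for E D
    using even_odd_decomposition_unique that by blast+
qed

end
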